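(* Let $R$ be a unital ring. Then $\Gamma(R)$ is flat, both as a left and as a right $\mathcal P(R)$-module.
   Context: $\Gamma(R)$ (Karoubi's cone) is the ring of matrices $A=(A_{ij})_{i,j\in\mathbb N}$ with entries in $R$ such that the set of entries $\{A_{ij}\}$ is finite and there is a uniform finite bound on the number of nonzero entries in each row and in each column. $\mathcal P(R)$ is the ring of sequences $\alpha\in R^{\mathbb N}$ taking finitely many distinct values, identified with the subring of diagonal matrices $\mathrm{diag}(\alpha)\in\Gamma(R)$. *)

theory Defs
  imports "HOL-Algebra.Algebra"
begin

section \<open>Left and right modules over a not necessarily commutative unital ring\<close>

locale left_module = R?: ring R + M?: abelian_group M
  for R :: "('r, 'a) ring_scheme" (structure)
    and M :: "('r, 'm, 'b) module_scheme" (structure) +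
  assumes smult_closed:
      "\<lbrakk>r \<in> carrier R; x \<in> carrier M\<rbrakk> \<Longrightarrow> r \<odot>\<^bsub>M\<^esub> x \<in> carrier M"
    and smult_l_distr:
      "\<lbrakk>r \<in> carrier R; s \<in> carrier R; x \<in> carrier M\<rbrakk>
        \<Longrightarrow> (r \<oplus>\<^bsub>R\<^esub> s) \<odot>\<^bsub>M\<^esub> x = r \<odot>\<^bsub>M\<^esub> x \<oplus>\<^bsub>M\<^esub> s \<odot>\<^bsub>M\<^esub> x"
    and smult_r_distr:
      "\<lbrakk>r \<in> carrier R; x \<in> carrier M; y \<in> carrier M\<rbrakk>
        \<Longrightarrow> r \<odot>\<^bsub>M\<^esub> (x \<oplus>\<^bsub>M\<^esub> y) = r \<odot>\<^bsub>M\<^esub> x \<oplus>\<^bsub>M\<^esub> r \<odot>\<^bsub>M\<^esub> y"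
    and smult_assoc:
      "\<lbrakk>r \<in> carrier R; s \<in> carrier R; x \<in> carrier M\<rbrakk>
        \<Longrightarrow> (r \<otimes>\<^bsub>R\<^esub> s) \<odot>\<^bsub>M\<^esub> x = r \<odot>\<^bsub>M\<^esub> (s \<odot>\<^bsub>M\<^esub> x)"
    and smult_one:
      "x \<in> carrier M \<Longrightarrow> \<one>\<^bsub>R\<^esub> \<odot>\<^bsub>M\<^esub> x = x"

text \<open>
  Right modules use the same record type: \<open>smult M r x\<close> then stands for the right action
  \<open>x \<cdot> r\<close>.  Hence the reversed associativity law \<open>x \<cdot> (r s) = (x \<cdot> r) \<cdot> s\<close>.
\<close>

locale right_module = R?: ring R + M?: abelian_group M
  for R :: "('r, 'a) ring_scheme" (structure)
    and M :: "('r, 'm, 'b) module_scheme" (structure) +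
  assumes smult_closed:
      "\<lbrakk>r \<in> carrier R; x \<in> carrier M\<rbrakk> \<Longrightarrow> r \<odot>\<^bsub>M\<^esub> x \<in> carrier M"
    and smult_l_distr:
      "\<lbrakk>r \<in> carrier R; s \<in> carrier R; x \<in> carrier M\<rbrakk>
        \<Longrightarrow> (r \<oplus>\<^bsub>R\<^esub> s) \<odot>\<^bsub>M\<^esub> x = r \<odot>\<^bsub>M\<^esub> x \<oplus>\<^bsub>M\<^esub> s \<odot>\<^bsub>M\<^esub> x"
    and smult_r_distr:
      "\<lbrakk>r \<in> carrier R; x \<in> carrier M; y \<in> carrier M\<rbrakk>
        \<Longrightarrow> r \<odot>\<^bsub>M\<^esub> (x \<oplus>\<^bsub>M\<^esub> y) = r \<odot>\<^bsub>M\<^esub> x \<oplus>\<^bsub>M\<^esub> r \<odot>\<^bsub>M\<^esub> y"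
    and smult_assoc:
      "\<lbrakk>r \<in> carrier R; s \<in> carrier R; x \<in> carrier M\<rbrakk>
        \<Longrightarrow> (r \<otimes>\<^bsub>R\<^esub> s) \<odot>\<^bsub>M\<^esub> x = s \<odot>\<^bsub>M\<^esub> (r \<odot>\<^bsub>M\<^esub> x)"
    and smult_one:
      "x \<in> carrier M \<Longrightarrow> \<one>\<^bsub>R\<^esub> \<odot>\<^bsub>M\<^esub> x = x"

text \<open>
  A map is linear when it is additive and commutes with the action; the same formula serves
  two left modules and two right modules.
\<close>

definition mod_hom ::
  "('r, 'a) ring_scheme \<Rightarrow> ('r, 'm, 'b) module_scheme \<Rightarrow> ('r, 'n, 'c) module_scheme \<Rightarrow> ('m \<Rightarrow> 'n) set"
  where "mod_hom R M N =
    {f \<in> carrier M \<rightarrow> carrier N.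
       (\<forall>x\<in>carrier M. \<forall>y\<in>carrier M. f (x \<oplus>\<^bsub>M\<^esub> y) = f x \<oplus>\<^bsub>N\<^esub> f y) \<and>
       (\<forall>r\<in>carrier R. \<forall>x\<in>carrier M. f (r \<odot>\<^bsub>M\<^esub> x) = r \<odot>\<^bsub>N\<^esub> f x)}"


section \<open>Tensor products and flatness\<close>

text \<open>
  For a right module \<open>M\<close> and a left module \<open>N\<close> over \<open>R\<close>, the abelian group
  \<open>M \<otimes>\<^sub>R N\<close> is the free abelian group on \<open>M \<times> N\<close> modulo the subgroup generated by
  \<open>(x + x', y) - (x, y) - (x', y)\<close>, \<open>(x, y + y') - (x, y) - (x, y')\<close> and
  \<open>(x \<cdot> r, y) - (x, r \<cdot> y)\<close>.  The ambient group is the library's \<open>free_Abelian_group\<close>, whose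
  group operation is written multiplicatively.
\<close>

definition tensor_relators ::
  "('r, 'a) ring_scheme \<Rightarrow> ('r, 'm, 'b) module_scheme \<Rightarrow> ('r, 'n, 'c) module_scheme
    \<Rightarrow> (('m \<times> 'n) \<Rightarrow>\<^sub>0 int) set"
  where "tensor_relators R M N =
    {frag_of (x \<oplus>\<^bsub>M\<^esub> x', y) - frag_of (x, y) - frag_of (x', y) | x x' y.
       x \<in> carrier M \<and> x' \<in> carrier M \<and> y \<in> carrier N} \<union>
    {frag_of (x, y \<oplus>\<^bsub>N\<^esub> y') - frag_of (x, y) - frag_of (x, y') | x y y'.
       x \<in> carrier M \<and> y \<in> carrier N \<and> y' \<in> carrier N} \<union>
    {frag_of (r \<odot>\<^bsub>M\<^esub> x, y) - frag_of (x, r \<odot>\<^bsub>N\<^esub> y) | r x y.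
       r \<in> carrier R \<and> x \<in> carrier M \<and> y \<in> carrier N}"

definition tensor_subgroup ::
  "('r, 'a) ring_scheme \<Rightarrow> ('r, 'm, 'b) module_scheme \<Rightarrow> ('r, 'n, 'c) module_scheme
    \<Rightarrow> (('m \<times> 'n) \<Rightarrow>\<^sub>0 int) set"
  where "tensor_subgroup R M N =
    generate (free_Abelian_group (carrier M \<times> carrier N)) (tensor_relators R M N)"

definition tensor ::
  "('r, 'a) ring_scheme \<Rightarrow> ('r, 'm, 'b) module_scheme \<Rightarrow> ('r, 'n, 'c) module_scheme
    \<Rightarrow> (('m \<times> 'n) \<Rightarrow>\<^sub>0 int) set monoid"
  where "tensor R M N =
    free_Abelian_group (carrier M \<times> carrier N) Mod tensor_subgroup R M N"

text \<open>
  The map \<open>g \<otimes> f : M \<otimes>\<^sub>R N \<rightarrow> M' \<otimes>\<^sub>R N'\<close>, which sends the class of \<open>(x, y)\<close> to the class of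
  \<open>(g x, f y)\<close>.  Only the target modules occur as arguments.  Elements of the tensor product are
  cosets; for linear \<open>g\<close> and \<open>f\<close> all members of the coset \<open>U\<close> have images in one and the same
  coset, so the union below is that coset.
\<close>

definition tensor_map ::
  "('r, 'a) ring_scheme \<Rightarrow> ('r, 'm2, 'b) module_scheme \<Rightarrow> ('r, 'n2, 'c) module_scheme
    \<Rightarrow> ('m1 \<Rightarrow> 'm2) \<Rightarrow> ('n1 \<Rightarrow> 'n2)
    \<Rightarrow> (('m1 \<times> 'n1) \<Rightarrow>\<^sub>0 int) set \<Rightarrow> (('m2 \<times> 'n2) \<Rightarrow>\<^sub>0 int) set"
  where "tensor_map R M' N' g f U =
    (\<Union>u\<in>U. tensor_subgroup R M' N' #>\<^bsub>free_Abelian_group (carrier M' \<times> carrier N')\<^esub>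
              frag_extend (\<lambda>(x, y). frag_of (g x, f y)) u)"

text \<open>
  A module is flat when tensoring with it preserves injectivity of linear maps.  A definition
  in HOL cannot quantify over types, so the carrier types of the test modules are passed as type
  arguments; a theorem in which these are type variables covers all test modules.
\<close>

definition flat_right_module ::
  "'n1 itself \<Rightarrow> 'n2 itself \<Rightarrow> ('r, 'a) ring_scheme \<Rightarrow> ('r, 'm, 'b) module_scheme \<Rightarrow> bool"
  where "flat_right_module _ _ R M \<longleftrightarrow>
    right_module R M \<and>
    (\<forall>(N :: ('r, 'n1) module) (N' :: ('r, 'n2) module) f.
       left_module R N \<and> left_module R N' \<and> f \<in> mod_hom R N N' \<and> inj_on f (carrier N)
       \<longrightarrow> inj_on (tensor_map R M N' (\<lambda>x. x) f) (carrier (tensor R M N)))"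

definition flat_left_module ::
  "'n1 itself \<Rightarrow> 'n2 itself \<Rightarrow> ('r, 'a) ring_scheme \<Rightarrow> ('r, 'm, 'b) module_scheme \<Rightarrow> bool"
  where "flat_left_module _ _ R M \<longleftrightarrow>
    left_module R M \<and>
    (\<forall>(N :: ('r, 'n1) module) (N' :: ('r, 'n2) module) f.
       right_module R N \<and> right_module R N' \<and> f \<in> mod_hom R N N' \<and> inj_on f (carrier N)
       \<longrightarrow> inj_on (tensor_map R N' M f (\<lambda>x. x)) (carrier (tensor R N M)))"


section \<open>Restriction of scalars\<close>

definition left_restrict_scalars ::
  "('r \<Rightarrow> 's) \<Rightarrow> ('s, 'a) ring_scheme \<Rightarrow> ('r, 's) module"
  where "left_restrict_scalars \<phi> S =
    \<lparr>carrier = carrier S, monoid.mult = (\<otimes>\<^bsub>S\<^esub>), monoid.one = \<one>\<^bsub>S\<^esub>,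
     ring.zero = \<zero>\<^bsub>S\<^esub>, ring.add = (\<oplus>\<^bsub>S\<^esub>), smult = (\<lambda>r x. \<phi> r \<otimes>\<^bsub>S\<^esub> x)\<rparr>"

definition right_restrict_scalars ::
  "('r \<Rightarrow> 's) \<Rightarrow> ('s, 'a) ring_scheme \<Rightarrow> ('r, 's) module"
  where "right_restrict_scalars \<phi> S =
    \<lparr>carrier = carrier S, monoid.mult = (\<otimes>\<^bsub>S\<^esub>), monoid.one = \<one>\<^bsub>S\<^esub>,
     ring.zero = \<zero>\<^bsub>S\<^esub>, ring.add = (\<oplus>\<^bsub>S\<^esub>), smult = (\<lambda>r x. x \<otimes>\<^bsub>S\<^esub> \<phi> r)\<rparr>"


section \<open>Karoubi's cone and its diagonal subring\<close>

definition karoubi_matrices :: "('a, 'b) ring_scheme \<Rightarrow> (nat \<Rightarrow> nat \<Rightarrow> 'a) set"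
  where "karoubi_matrices R =
    {A. (\<forall>i j. A i j \<in> carrier R) \<and>
        finite {A i j | i j. True} \<and>
        (\<exists>n. (\<forall>i. finite {j. A i j \<noteq> \<zero>\<^bsub>R\<^esub>} \<and> card {j. A i j \<noteq> \<zero>\<^bsub>R\<^esub>} \<le> n) \<and>
             (\<forall>j. finite {i. A i j \<noteq> \<zero>\<^bsub>R\<^esub>} \<and> card {i. A i j \<noteq> \<zero>\<^bsub>R\<^esub>} \<le> n))}"

definition diag_matrix :: "('a, 'b) ring_scheme \<Rightarrow> (nat \<Rightarrow> 'a) \<Rightarrow> nat \<Rightarrow> nat \<Rightarrow> 'a"
  where "diag_matrix R \<alpha> = (\<lambda>i j. if i = j then \<alpha> i else \<zero>\<^bsub>R\<^esub>)"

text \<open>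
  In the matrix product \<open>\<Sum>k. A i k * B k j\<close> the sum is restricted to the nonzero terms,
  because \<open>finsum\<close> over an infinite index set is \<open>\<zero>\<close> by convention.
\<close>

definition Karoubi_cone :: "('a, 'b) ring_scheme \<Rightarrow> (nat \<Rightarrow> nat \<Rightarrow> 'a) ring"
  where "Karoubi_cone R =
    \<lparr>carrier = karoubi_matrices R,
     monoid.mult = (\<lambda>A B i j.
       \<Oplus>\<^bsub>R\<^esub>k \<in> {k. A i k \<otimes>\<^bsub>R\<^esub> B k j \<noteq> \<zero>\<^bsub>R\<^esub>}. A i k \<otimes>\<^bsub>R\<^esub> B k j),
     monoid.one = diag_matrix R (\<lambda>_. \<one>\<^bsub>R\<^esub>),
     ring.zero = (\<lambda>_ _. \<zero>\<^bsub>R\<^esub>),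
     ring.add = (\<lambda>A B i j. A i j \<oplus>\<^bsub>R\<^esub> B i j)\<rparr>"

definition finite_valued_sequences :: "('a, 'b) ring_scheme \<Rightarrow> (nat \<Rightarrow> 'a) ring"
  where "finite_valued_sequences R =
    \<lparr>carrier = {\<alpha>. range \<alpha> \<subseteq> carrier R \<and> finite (range \<alpha>)},
     monoid.mult = (\<lambda>\<alpha> \<beta> i. \<alpha> i \<otimes>\<^bsub>R\<^esub> \<beta> i),
     monoid.one = (\<lambda>_. \<one>\<^bsub>R\<^esub>),
     ring.zero = (\<lambda>_. \<zero>\<^bsub>R\<^esub>),
     ring.add = (\<lambda>\<alpha> \<beta> i. \<alpha> i \<oplus>\<^bsub>R\<^esub> \<beta> i)\<rparr>"

end

theory Submission
  imports Defs
begin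

text \<open>
  Finitely many matrices of the cone are supported on a set of positions of bounded degree, hence on
  finitely many pairwise disjoint graphs \<open>G k\<close> of partial injections. Writing \<open>w k\<close> for the
  \<open>0/1\<close>-matrix of \<open>G k\<close> and \<open>p k A\<close> for the sequence of entries of \<open>A\<close> along \<open>G k\<close>, each of these
  matrices is \<open>\<Sum> p k A \<cdot> w k\<close>, and every \<open>p k\<close> is a linear functional on the whole cone. Such local
  coordinate systems imply flatness: an element of the tensor product is determined, through the
  \<open>w k\<close>, by its images under the \<open>p k\<close>, which lie in the test module itself.
\<close>

section \<open>The relation subgroup\<close>

text \<open>An expansion is only asked for the matrices occurring in one tensor, but the functionals
  must be linear on every matrix: a chain of relations showing that the image of the tensor vanishes
  may pass through matrices outside the given finite set. The two finiteness conditions on the cone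
  enter at different places. The uniform bound on rows and columns lets finitely many graphs
  suffice; finiteness of the set of entries makes the entries along a graph a member of the scalar
  ring. Graphs injective in both directions serve both sides. A left scalar acts through the row
  index, so coordinates must be sequences indexed by rows, with at most one column for each row; for
  right scalars rows and columns exchange roles. The argument runs with formal combinations modulo
  relations; cosets are met only when injectivity is translated into the statement that relations
  are reflected.\<close>

text \<open>
  The laws shared by left and right modules; the order of multiplication in the scalar ring is
  only needed for the balancing hypothesis of \<open>tensor_subgroup_reflects\<close> below.
\<close>

locale distributive_action = abelian_group M
  for R :: "('r, 'a) ring_scheme" and M :: "('r, 'm, 'b) module_scheme" +
  assumes act_closed: "\<lbrakk>r \<in> carrier R; x \<in> carrier M\<rbrakk> \<Longrightarrow> r \<odot>\<^bsub>M\<^esub> x \<in> carrier M"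
    and act_add_left: "\<lbrakk>r \<in> carrier R; s \<in> carrier R; x \<in> carrier M\<rbrakk>
      \<Longrightarrow> (r \<oplus>\<^bsub>R\<^esub> s) \<odot>\<^bsub>M\<^esub> x = r \<odot>\<^bsub>M\<^esub> x \<oplus>\<^bsub>M\<^esub> s \<odot>\<^bsub>M\<^esub> x"
    and act_add_right: "\<lbrakk>r \<in> carrier R; x \<in> carrier M; y \<in> carrier M\<rbrakk>
      \<Longrightarrow> r \<odot>\<^bsub>M\<^esub> (x \<oplus>\<^bsub>M\<^esub> y) = r \<odot>\<^bsub>M\<^esub> x \<oplus>\<^bsub>M\<^esub> r \<odot>\<^bsub>M\<^esub> y"

lemma left_module_action: "left_module R M \<Longrightarrow> distributive_action R M"
  by (auto simp: left_module_def left_module_axioms_def distributive_action_def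
      distributive_action_axioms_def)

lemma right_module_action: "right_module R M \<Longrightarrow> distributive_action R M"
  by (auto simp: right_module_def right_module_axioms_def distributive_action_def
      distributive_action_axioms_def)

lemma tensor_relators_closed:
  assumes "distributive_action R M" "distributive_action R N"
  shows "tensor_relators R M N \<subseteq> carrier (free_Abelian_group (carrier M \<times> carrier N))"
proof -
  interpret M: distributive_action R M by fact
  interpret N: distributive_action R N by fact
  show ?thesis
    by (auto simp: tensor_relators_def M.act_closed N.act_closed dest!: subsetD[OF keys_diff])
qed

context
  fixes R :: "('r, 'a) ring_scheme" and M :: "('r, 'm, 'b) module_scheme"
    and N :: "('r, 'n, 'c) module_scheme"
  assumes M: "distributive_action R M" and N: "distributive_action R N"
begin

interpretation M: distributive_action R M by (fact M)
interpretation N: distributive_action R N by (fact N)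

lemma subgroup_tensor_subgroup:
  "subgroup (tensor_subgroup R M N) (free_Abelian_group (carrier M \<times> carrier N))"
  unfolding tensor_subgroup_def
  by (intro group.generate_is_subgroup group_free_Abelian_group tensor_relators_closed M N)

lemma tensor_subgroup_keys:
  "a \<in> tensor_subgroup R M N \<Longrightarrow> Poly_Mapping.keys a \<subseteq> carrier M \<times> carrier N"
  by (metis carrier_free_Abelian_group_iff subgroup.mem_carrier subgroup_tensor_subgroup)

lemma tensor_subgroup_zero: "0 \<in> tensor_subgroup R M N"
  using subgroup.one_closed[OF subgroup_tensor_subgroup] by simp

lemma tensor_subgroup_add:
  "\<lbrakk>a \<in> tensor_subgroup R M N; b \<in> tensor_subgroup R M N\<rbrakk> \<Longrightarrow> a + b \<in> tensor_subgroup R M N"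
  using subgroup.m_closed[OF subgroup_tensor_subgroup] by simp

lemma tensor_subgroup_minus:
  "a \<in> tensor_subgroup R M N \<Longrightarrow> - a \<in> tensor_subgroup R M N"
  using subgroup.m_inv_closed[OF subgroup_tensor_subgroup, of a] tensor_subgroup_keys by simp

lemma tensor_subgroup_diff:
  "\<lbrakk>a \<in> tensor_subgroup R M N; b \<in> tensor_subgroup R M N\<rbrakk> \<Longrightarrow> a - b \<in> tensor_subgroup R M N"
  using tensor_subgroup_add[of a "- b"] tensor_subgroup_minus by simp

lemma tensor_subgroup_sum:
  "(\<And>i. i \<in> I \<Longrightarrow> a i \<in> tensor_subgroup R M N) \<Longrightarrow> sum a I \<in> tensor_subgroup R M N"
  by (induction I rule: infinite_finite_induct) (auto intro: tensor_subgroup_zero tensor_subgroup_add)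

lemma tensor_relator_left:
  assumes "x \<in> carrier M" "x' \<in> carrier M" "y \<in> carrier N"
  shows "frag_of (x \<oplus>\<^bsub>M\<^esub> x', y) - frag_of (x, y) - frag_of (x', y) \<in> tensor_subgroup R M N"
  using assms unfolding tensor_subgroup_def tensor_relators_def
  by (intro generate.incl) blast

lemma tensor_relator_right:
  assumes "x \<in> carrier M" "y \<in> carrier N" "y' \<in> carrier N"
  shows "frag_of (x, y \<oplus>\<^bsub>N\<^esub> y') - frag_of (x, y) - frag_of (x, y') \<in> tensor_subgroup R M N"
  using assms unfolding tensor_subgroup_def tensor_relators_def
  by (intro generate.incl) blast

lemma tensor_relator_balanced:
  assumes "r \<in> carrier R" "x \<in> carrier M" "y \<in> carrier N"
  shows "frag_of (r \<odot>\<^bsub>M\<^esub> x, y) - frag_of (x, r \<odot>\<^bsub>N\<^esub> y) \<in> tensor_subgroup R M N"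
  using assms unfolding tensor_subgroup_def tensor_relators_def
  by (intro generate.incl) blast

text \<open>The additivity relator for zero plus zero collapses to minus this generator.\<close>

lemma tensor_zero_left:
  assumes "y \<in> carrier N" shows "frag_of (\<zero>\<^bsub>M\<^esub>, y) \<in> tensor_subgroup R M N"
  using tensor_subgroup_minus[OF tensor_relator_left[of "\<zero>\<^bsub>M\<^esub>" "\<zero>\<^bsub>M\<^esub>" y]] assms by simp

lemma tensor_zero_right:
  assumes "x \<in> carrier M" shows "frag_of (x, \<zero>\<^bsub>N\<^esub>) \<in> tensor_subgroup R M N"
  using tensor_subgroup_minus[OF tensor_relator_right[of x "\<zero>\<^bsub>N\<^esub>" "\<zero>\<^bsub>N\<^esub>"]] assms by simp

text \<open>Additivity is applied to \<open>y\<close> written as the difference plus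
  \<open>y'\<close>. Differences rather than sums are wanted because \<open>frag_induction\<close>
  builds formal combinations by subtraction.\<close>

lemma tensor_diff_right:
  assumes "x \<in> carrier M" "y \<in> carrier N" "y' \<in> carrier N"
  shows "frag_of (x, y \<ominus>\<^bsub>N\<^esub> y') - (frag_of (x, y) - frag_of (x, y')) \<in> tensor_subgroup R M N"
proof -
  have eq: "(y \<ominus>\<^bsub>N\<^esub> y') \<oplus>\<^bsub>N\<^esub> y' = y"
    using assms by (simp add: N.minus_eq N.a_assoc N.l_neg)
  have "- (frag_of (x, y) - frag_of (x, y \<ominus>\<^bsub>N\<^esub> y') - frag_of (x, y')) \<in> tensor_subgroup R M N"
    using tensor_subgroup_minus[OF tensor_relator_right[of x "y \<ominus>\<^bsub>N\<^esub> y'" y']] assms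
    unfolding eq by simp
  then show ?thesis by (simp add: algebra_simps)
qed

lemma tensor_finsum_left:
  assumes "finite I" "a \<in> I \<rightarrow> carrier M" "y \<in> carrier N"
  shows "frag_of (finsum M a I, y) - (\<Sum>i\<in>I. frag_of (a i, y)) \<in> tensor_subgroup R M N"
  using assms(1,2)
proof (induction I)
  case empty
  then show ?case using tensor_zero_left assms(3) by simp
next
  case (insert i I)
  then have IH: "frag_of (finsum M a I, y) - (\<Sum>i\<in>I. frag_of (a i, y)) \<in> tensor_subgroup R M N"
    and a: "a i \<in> carrier M" "a \<in> I \<rightarrow> carrier M"
    by auto
  have "(frag_of (a i \<oplus>\<^bsub>M\<^esub> finsum M a I, y) - frag_of (a i, y) - frag_of (finsum M a I, y))
    + (frag_of (finsum M a I, y) - (\<Sum>i\<in>I. frag_of (a i, y))) \<in> tensor_subgroup R M N"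
    using assms(3) a by (intro tensor_subgroup_add tensor_relator_left IH) auto
  then show ?case using insert.hyps a by (simp add: algebra_simps)
qed

text \<open>The universal property of the tensor product, kept on the free group: a balanced
  biadditive map extends to formal combinations, and every relator lies in the kernel of the
  extension. It is applied with a test module itself as the target group.\<close>

lemma tensor_universal:
  fixes A :: "('x, 'y) ring_scheme"
  assumes A: "abelian_group A"
    and closed: "\<And>x y. \<lbrakk>x \<in> carrier M; y \<in> carrier N\<rbrakk> \<Longrightarrow> \<beta> x y \<in> carrier A"
    and left: "\<And>x x' y. \<lbrakk>x \<in> carrier M; x' \<in> carrier M; y \<in> carrier N\<rbrakk>
      \<Longrightarrow> \<beta> (x \<oplus>\<^bsub>M\<^esub> x') y = \<beta> x y \<oplus>\<^bsub>A\<^esub> \<beta> x' y"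
    and right: "\<And>x y y'. \<lbrakk>x \<in> carrier M; y \<in> carrier N; y' \<in> carrier N\<rbrakk>
      \<Longrightarrow> \<beta> x (y \<oplus>\<^bsub>N\<^esub> y') = \<beta> x y \<oplus>\<^bsub>A\<^esub> \<beta> x y'"
    and balanced: "\<And>r x y. \<lbrakk>r \<in> carrier R; x \<in> carrier M; y \<in> carrier N\<rbrakk>
      \<Longrightarrow> \<beta> (r \<odot>\<^bsub>M\<^esub> x) y = \<beta> x (r \<odot>\<^bsub>N\<^esub> y)"
  obtains h where
    "\<And>a. Poly_Mapping.keys a \<subseteq> carrier M \<times> carrier N \<Longrightarrow> h a \<in> carrier A"
    "\<And>a b. \<lbrakk>Poly_Mapping.keys a \<subseteq> carrier M \<times> carrier N; Poly_Mapping.keys b \<subseteq> carrier M \<times> carrier N\<rbrakk>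
      \<Longrightarrow> h (a - b) = h a \<ominus>\<^bsub>A\<^esub> h b"
    "\<And>x y. \<lbrakk>x \<in> carrier M; y \<in> carrier N\<rbrakk> \<Longrightarrow> h (frag_of (x, y)) = \<beta> x y"
    "\<And>a. a \<in> tensor_subgroup R M N \<Longrightarrow> h a = \<zero>\<^bsub>A\<^esub>"
proof -
  interpret A: abelian_group A by fact
  let ?F = "free_Abelian_group (carrier M \<times> carrier N)"
  interpret F: group ?F by simp
  have "case_prod \<beta> ` (carrier M \<times> carrier N) \<subseteq> carrier A"
    using closed by auto
  then obtain h where h: "h \<in> hom ?F (add_monoid A)"
    and h_of: "\<And>z. z \<in> carrier M \<times> carrier N \<Longrightarrow> h (frag_of z) = case_prod \<beta> z"
    by (metis comm_group.free_Abelian_group_universal[OF A.a_comm_group] partial_object.select_convs(1))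
  interpret h: group_hom ?F "add_monoid A" h
    using h by unfold_locales
  have h_closed: "h a \<in> carrier A" if "Poly_Mapping.keys a \<subseteq> carrier M \<times> carrier N" for a
    using h.hom_closed[of a] that by simp
  have h_diff: "h (a - b) = h a \<ominus>\<^bsub>A\<^esub> h b"
    if "Poly_Mapping.keys a \<subseteq> carrier M \<times> carrier N" "Poly_Mapping.keys b \<subseteq> carrier M \<times> carrier N"
    for a b
    using h.hom_mult[of a "- b"] h.hom_inv[of b] that by (simp add: a_minus_def a_inv_def)
  \<comment> \<open>Biadditivity of the given map turns both kinds of additivity relators into this
    expression.\<close>
  have cancel: "(u \<oplus>\<^bsub>A\<^esub> v) \<ominus>\<^bsub>A\<^esub> u \<ominus>\<^bsub>A\<^esub> v = \<zero>\<^bsub>A\<^esub>" if "u \<in> carrier A" "v \<in> carrier A" for u v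
  proof -
    have "(u \<oplus>\<^bsub>A\<^esub> v) \<ominus>\<^bsub>A\<^esub> u = v"
      using that by (simp add: A.minus_eq A.a_comm[of u v] A.a_assoc A.r_neg)
    then show ?thesis using that by (simp add: A.minus_eq A.r_neg)
  qed
  have keys2: "Poly_Mapping.keys (frag_of z - frag_of z') \<subseteq> carrier M \<times> carrier N"
    if "z \<in> carrier M \<times> carrier N" "z' \<in> carrier M \<times> carrier N" for z z'
    using that by (auto dest!: subsetD[OF keys_diff])
  have h_rel: "h a = \<zero>\<^bsub>A\<^esub>" if "a \<in> tensor_relators R M N" for a
    using that unfolding tensor_relators_def
    by (elim UnE CollectE exE conjE)
      (simp_all add: h_diff h_of keys2 cancel left right balanced closed M.act_closed N.act_closed,
       simp_all add: A.minus_eq A.r_neg closed M.act_closed N.act_closed)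
  have h_sub: "h a = \<zero>\<^bsub>A\<^esub>" if "a \<in> tensor_subgroup R M N" for a
  proof -
    have "tensor_subgroup R M N \<subseteq> kernel ?F (add_monoid A) h"
      unfolding tensor_subgroup_def
      using subsetD[OF tensor_relators_closed[OF M N]]
      by (intro F.generate_subgroup_incl h.subgroup_kernel subsetI) (simp_all add: kernel_def h_rel)
    then show ?thesis using that by (auto simp: kernel_def)
  qed
  show thesis
    by (rule that[of h]) (auto simp: h_closed h_diff h_of h_sub)
qed

end

section \<open>Flatness from finitely many coordinates\<close>

text \<open>
  The second tensor factor of \<open>t\<close> is collected in \<open>h k t = \<Sum> p k x \<cdot> y\<close>, so that \<open>t\<close> is
  congruent to \<open>\<Sum> w k \<otimes> h k t\<close>.  The coordinates \<open>h k\<close> also exist on the target, where they vanish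
  on the image of \<open>t\<close>; injectivity of \<open>f\<close> then kills \<open>h k t\<close> itself.
\<close>

lemma tensor_subgroup_reflects:
  fixes R :: "('r, 'a) ring_scheme" and M :: "('r, 'm, 'b) module_scheme"
    and N :: "('r, 'n, 'c) module_scheme" and N' :: "('r, 'l, 'd) module_scheme"
  assumes M: "distributive_action R M" and N: "distributive_action R N"
    and N': "distributive_action R N'"
    and f: "f \<in> mod_hom R N N'" and inj: "inj_on f (carrier N)"
    and I: "finite I"
    and w: "\<And>k. k \<in> I \<Longrightarrow> w k \<in> carrier M"
    and p: "\<And>k x. \<lbrakk>k \<in> I; x \<in> carrier M\<rbrakk> \<Longrightarrow> p k x \<in> carrier R"
    and p_add: "\<And>k x x'. \<lbrakk>k \<in> I; x \<in> carrier M; x' \<in> carrier M\<rbrakk>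
      \<Longrightarrow> p k (x \<oplus>\<^bsub>M\<^esub> x') = p k x \<oplus>\<^bsub>R\<^esub> p k x'"
    and p_balanced: "\<And>k r x y. \<lbrakk>k \<in> I; r \<in> carrier R; x \<in> carrier M; y \<in> carrier N'\<rbrakk>
      \<Longrightarrow> p k (r \<odot>\<^bsub>M\<^esub> x) \<odot>\<^bsub>N'\<^esub> y = p k x \<odot>\<^bsub>N'\<^esub> (r \<odot>\<^bsub>N'\<^esub> y)"
    and B: "B \<subseteq> carrier M"
    and expand: "\<And>x. x \<in> B \<Longrightarrow> x = finsum M (\<lambda>k. p k x \<odot>\<^bsub>M\<^esub> w k) I"
    and t: "Poly_Mapping.keys t \<subseteq> B \<times> carrier N"
    and image: "frag_extend (\<lambda>(x, y). frag_of (x, f y)) t \<in> tensor_subgroup R M N'"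
  shows "t \<in> tensor_subgroup R M N"
proof -
  interpret M: distributive_action R M by fact
  interpret N: distributive_action R N by fact
  interpret N': distributive_action R N' by fact
  let ?F = "frag_extend (\<lambda>(x, y). frag_of (x, f y)) :: ('m \<times> 'n \<Rightarrow>\<^sub>0 int) \<Rightarrow> _"
  have f_closed: "f y \<in> carrier N'" if "y \<in> carrier N" for y
    using f that by (auto simp: mod_hom_def)
  have f_add: "f (y \<oplus>\<^bsub>N\<^esub> y') = f y \<oplus>\<^bsub>N'\<^esub> f y'" if "y \<in> carrier N" "y' \<in> carrier N" for y y'
    using f that by (auto simp: mod_hom_def)
  have f_act: "f (r \<odot>\<^bsub>N\<^esub> y) = r \<odot>\<^bsub>N'\<^esub> f y" if "r \<in> carrier R" "y \<in> carrier N" for r y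
    using f that by (auto simp: mod_hom_def)
  have f_hom: "f \<in> hom (add_monoid N) (add_monoid N')"
    by (auto simp: hom_def f_closed f_add)
  interpret f: group_hom "add_monoid N" "add_monoid N'" f
    by (intro group_hom.intro group_hom_axioms.intro f_hom N.a_group N'.a_group)
  have f_zero: "f \<zero>\<^bsub>N\<^esub> = \<zero>\<^bsub>N'\<^esub>" using f.hom_one by simp
  have f_diff: "f (y \<ominus>\<^bsub>N\<^esub> y') = f y \<ominus>\<^bsub>N'\<^esub> f y'" if "y \<in> carrier N" "y' \<in> carrier N" for y y'
    using f.hom_inv[of y'] that by (simp add: a_minus_def a_inv_def f_add flip: a_inv_def)
  have keys_F: "Poly_Mapping.keys (?F a) \<subseteq> carrier M \<times> carrier N'"
    if "Poly_Mapping.keys a \<subseteq> carrier M \<times> carrier N" for a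
    using that f_closed by (intro order_trans[OF keys_frag_extend]) auto
  \<comment> \<open>All properties of a coordinate map are bundled so that a single choice over
    \<open>k\<close> supplies them together. The last clause is what the target is needed for: the
    map vanishes wherever the image is a relation.\<close>
  define coord where "coord k g \<longleftrightarrow>
      (\<forall>a. Poly_Mapping.keys a \<subseteq> carrier M \<times> carrier N \<longrightarrow> g a \<in> carrier N) \<and>
      (\<forall>a b. Poly_Mapping.keys a \<subseteq> carrier M \<times> carrier N \<longrightarrow>
        Poly_Mapping.keys b \<subseteq> carrier M \<times> carrier N \<longrightarrow> g (a - b) = g a \<ominus>\<^bsub>N\<^esub> g b) \<and>
      (\<forall>x\<in>carrier M. \<forall>y\<in>carrier N. g (frag_of (x, y)) = p k x \<odot>\<^bsub>N\<^esub> y) \<and>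
      (\<forall>a. Poly_Mapping.keys a \<subseteq> carrier M \<times> carrier N \<longrightarrow>
        ?F a \<in> tensor_subgroup R M N' \<longrightarrow> g a = \<zero>\<^bsub>N\<^esub>)" for k g
  have "\<exists>g. coord k g"
    if k: "k \<in> I" for k
  proof -
    \<comment> \<open>Balancing is assumed over \<open>N'\<close> only; over \<open>N\<close> it is
      pulled back, since \<open>f\<close> is linear and injective.\<close>
    have balanced: "p k (r \<odot>\<^bsub>M\<^esub> x) \<odot>\<^bsub>N\<^esub> y = p k x \<odot>\<^bsub>N\<^esub> (r \<odot>\<^bsub>N\<^esub> y)"
      if "r \<in> carrier R" "x \<in> carrier M" "y \<in> carrier N" for r x y
      using that k by (intro inj_onD[OF inj])
        (auto simp: f_act p p_balanced f_closed N.act_closed M.act_closed)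
    obtain h where
        h: "\<And>a. Poly_Mapping.keys a \<subseteq> carrier M \<times> carrier N \<Longrightarrow> h a \<in> carrier N"
      and h_diff: "\<And>a b. \<lbrakk>Poly_Mapping.keys a \<subseteq> carrier M \<times> carrier N;
          Poly_Mapping.keys b \<subseteq> carrier M \<times> carrier N\<rbrakk> \<Longrightarrow> h (a - b) = h a \<ominus>\<^bsub>N\<^esub> h b"
      and h_of: "\<And>x y. \<lbrakk>x \<in> carrier M; y \<in> carrier N\<rbrakk> \<Longrightarrow> h (frag_of (x, y)) = p k x \<odot>\<^bsub>N\<^esub> y"
      by (rule tensor_universal[OF M N N.abelian_group_axioms, where \<beta> = "\<lambda>x y. p k x \<odot>\<^bsub>N\<^esub> y"])
        (use k in \<open>auto simp: p p_add balanced N.act_closed N.act_add_left N.act_add_right\<close>)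
    obtain h' where
        h': "\<And>a. Poly_Mapping.keys a \<subseteq> carrier M \<times> carrier N' \<Longrightarrow> h' a \<in> carrier N'"
      and h'_diff: "\<And>a b. \<lbrakk>Poly_Mapping.keys a \<subseteq> carrier M \<times> carrier N';
          Poly_Mapping.keys b \<subseteq> carrier M \<times> carrier N'\<rbrakk> \<Longrightarrow> h' (a - b) = h' a \<ominus>\<^bsub>N'\<^esub> h' b"
      and h'_of: "\<And>x y. \<lbrakk>x \<in> carrier M; y \<in> carrier N'\<rbrakk> \<Longrightarrow> h' (frag_of (x, y)) = p k x \<odot>\<^bsub>N'\<^esub> y"
      and h'_zero: "\<And>a. a \<in> tensor_subgroup R M N' \<Longrightarrow> h' a = \<zero>\<^bsub>N'\<^esub>"
      by (rule tensor_universal[OF M N' N'.abelian_group_axioms, where \<beta> = "\<lambda>x y. p k x \<odot>\<^bsub>N'\<^esub> y"])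
        (use k in \<open>auto simp: p p_add p_balanced N'.act_closed N'.act_add_left N'.act_add_right\<close>)
    have h_0: "h 0 = \<zero>\<^bsub>N\<^esub>" using h_diff[of 0 0] h[of 0] by (simp add: N.minus_eq N.r_neg)
    have h'_0: "h' 0 = \<zero>\<^bsub>N'\<^esub>" by (rule h'_zero[OF tensor_subgroup_zero[OF M N']])
    \<comment> \<open>Naturality of the coordinate with respect to \<open>f\<close>. The support
      condition is repeated in the conclusion because the difference case of
      \<open>frag_induction\<close> supplies nothing but the induction hypotheses.\<close>
    have nat: "Poly_Mapping.keys a \<subseteq> carrier M \<times> carrier N \<and> f (h a) = h' (?F a)"
      if "Poly_Mapping.keys a \<subseteq> carrier M \<times> carrier N" for a
      using that
    proof (induction a rule: frag_induction)
      case zero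
      show ?case by (simp add: h_0 h'_0 f_zero)
    next
      case (one z)
      then show ?case using k by (auto simp: h_of h'_of f_act f_closed p)
    next
      case (diff a b)
      then show ?case
        by (auto simp: frag_extend_diff h_diff h'_diff keys_F f_diff h dest: subsetD[OF keys_diff])
    qed
    \<comment> \<open>Naturality gives \<open>f (h a) = h' (?F a)\<close>, which is zero because
      \<open>h'\<close> kills relations; injectivity of \<open>f\<close> does the rest.\<close>
    have "h a = \<zero>\<^bsub>N\<^esub>"
      if "Poly_Mapping.keys a \<subseteq> carrier M \<times> carrier N" "?F a \<in> tensor_subgroup R M N'" for a
      using nat[OF that(1)] h'_zero[OF that(2)] f_zero h[OF that(1)]
      by (intro inj_onD[OF inj]) auto
    then have "coord k h" unfolding coord_def using h h_diff h_of by (intro conjI allI ballI impI)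
    then show ?thesis by (rule exI[of _ h])
  qed
  then obtain h where coord: "\<And>k. k \<in> I \<Longrightarrow> coord k (h k)"
    by metis
  then have
      h: "\<And>k a. \<lbrakk>k \<in> I; Poly_Mapping.keys a \<subseteq> carrier M \<times> carrier N\<rbrakk> \<Longrightarrow> h k a \<in> carrier N"
    and h_diff: "\<And>k a b. \<lbrakk>k \<in> I; Poly_Mapping.keys a \<subseteq> carrier M \<times> carrier N;
        Poly_Mapping.keys b \<subseteq> carrier M \<times> carrier N\<rbrakk> \<Longrightarrow> h k (a - b) = h k a \<ominus>\<^bsub>N\<^esub> h k b"
    and h_of: "\<And>k x y. \<lbrakk>k \<in> I; x \<in> carrier M; y \<in> carrier N\<rbrakk>
        \<Longrightarrow> h k (frag_of (x, y)) = p k x \<odot>\<^bsub>N\<^esub> y"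
    and h_zero: "\<And>k a. \<lbrakk>k \<in> I; Poly_Mapping.keys a \<subseteq> carrier M \<times> carrier N;
        ?F a \<in> tensor_subgroup R M N'\<rbrakk> \<Longrightarrow> h k a = \<zero>\<^bsub>N\<^esub>"
    by (simp_all add: coord_def)
  note sub = tensor_subgroup_zero[OF M N] tensor_subgroup_add[OF M N] tensor_subgroup_diff[OF M N]
    tensor_subgroup_sum[OF M N]
  have h_0: "h k 0 = \<zero>\<^bsub>N\<^esub>" if "k \<in> I" for k
    using h_zero[of k 0] that tensor_subgroup_zero[OF M N'] by simp
  \<comment> \<open>A generator with zero second entry is a nonzero formal element, merely a
    relation. Such terms occur in the base case and again once the coordinates of \<open>t\<close>
    are known to vanish.\<close>
  have zeros: "(\<Sum>k\<in>I. frag_of (w k, \<zero>\<^bsub>N\<^esub>)) \<in> tensor_subgroup R M N"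
    by (intro sub tensor_zero_right[OF M N] w)
  have "Poly_Mapping.keys t \<subseteq> B \<times> carrier N \<and>
      t - (\<Sum>k\<in>I. frag_of (w k, h k t)) \<in> tensor_subgroup R M N"
    using t
  proof (induction t rule: frag_induction)
    case zero
    show ?case using tensor_subgroup_minus[OF M N zeros] by (simp add: h_0)
  next
    case (one z)
    obtain x y where z: "z = (x, y)" and x: "x \<in> B" and y: "y \<in> carrier N"
      using one by auto
    with B have xM: "x \<in> carrier M" by auto
    \<comment> \<open>Expand \<open>x\<close>, split the sum in the first factor, then move each
      coefficient across to \<open>y\<close>. This is where membership of \<open>x\<close> in
      \<open>B\<close> is exploited.\<close>
    have "(frag_of (finsum M (\<lambda>k. p k x \<odot>\<^bsub>M\<^esub> w k) I, y) - (\<Sum>k\<in>I. frag_of (p k x \<odot>\<^bsub>M\<^esub> w k, y)))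
        + (\<Sum>k\<in>I. frag_of (p k x \<odot>\<^bsub>M\<^esub> w k, y) - frag_of (w k, p k x \<odot>\<^bsub>N\<^esub> y))
        \<in> tensor_subgroup R M N"
      by (intro sub tensor_finsum_left[OF M N] tensor_relator_balanced[OF M N])
        (auto simp: I w p xM y M.act_closed)
    then show ?case
      using x y xM by (simp add: z h_of sum_subtractf flip: expand)
  next
    case (diff a b)
    then have keys: "Poly_Mapping.keys a \<subseteq> carrier M \<times> carrier N"
        "Poly_Mapping.keys b \<subseteq> carrier M \<times> carrier N"
      using B by auto
    \<comment> \<open>The coordinate of \<open>a - b\<close> sits inside one generator for each
      \<open>k\<close>, so the difference has to be pulled out by relations; the last sum is this
      correction.\<close>
    have "(a - (\<Sum>k\<in>I. frag_of (w k, h k a))) - (b - (\<Sum>k\<in>I. frag_of (w k, h k b)))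
        - (\<Sum>k\<in>I. frag_of (w k, h k a \<ominus>\<^bsub>N\<^esub> h k b) - (frag_of (w k, h k a) - frag_of (w k, h k b)))
        \<in> tensor_subgroup R M N"
      using diff keys
      by (intro sub(3)[OF sub(3) sub(4)] tensor_diff_right[OF M N]) (simp_all add: w h)
    then show ?case
      using diff keys keys_diff[of a b] by (auto simp: h_diff sum_subtractf sum.distrib algebra_simps)
  qed
  moreover have "h k t = \<zero>\<^bsub>N\<^esub>" if "k \<in> I" for k
    using h_zero[OF that _ image] t B by blast
  ultimately have "t - (\<Sum>k\<in>I. frag_of (w k, \<zero>\<^bsub>N\<^esub>)) \<in> tensor_subgroup R M N" by simp
  from sub(2)[OF this zeros] show ?thesis by simp
qed

text \<open>Two cosets with the same image have representatives whose difference is sent to a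
  relation, so injectivity reduces to reflecting relations. A map in each factor is allowed so that
  the same reduction serves both kinds of flatness.\<close>

lemma inj_on_tensor_map:
  fixes R :: "('r, 'a) ring_scheme" and M :: "('r, 'm, 'b) module_scheme"
    and N :: "('r, 'n, 'c) module_scheme" and M' :: "('r, 'k, 'd) module_scheme"
    and N' :: "('r, 'l, 'e) module_scheme"
  assumes M: "distributive_action R M" and N: "distributive_action R N"
    and M': "distributive_action R M'" and N': "distributive_action R N'"
    and reflects: "\<And>t. \<lbrakk>Poly_Mapping.keys t \<subseteq> carrier M \<times> carrier N;
        frag_extend (\<lambda>(x, y). frag_of (g x, f y)) t \<in> tensor_subgroup R M' N'\<rbrakk>
      \<Longrightarrow> t \<in> tensor_subgroup R M N"
  shows "inj_on (tensor_map R M' N' g f) (carrier (tensor R M N))"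
proof (rule inj_onI)
  let ?G = "free_Abelian_group (carrier M \<times> carrier N)"
    and ?G' = "free_Abelian_group (carrier M' \<times> carrier N')"
    and ?K = "tensor_subgroup R M N" and ?K' = "tensor_subgroup R M' N'"
    and ?F = "frag_extend (\<lambda>(x, y). frag_of (g x, f y))"
  interpret G: group ?G by simp
  note K = subgroup_tensor_subgroup[OF M N]
  fix U V
  assume U: "U \<in> carrier (tensor R M N)" and V: "V \<in> carrier (tensor R M N)"
    and eq: "tensor_map R M' N' g f U = tensor_map R M' N' g f V"
  obtain u v where u: "Poly_Mapping.keys u \<subseteq> carrier M \<times> carrier N" "U = ?K #>\<^bsub>?G\<^esub> u"
    and v: "Poly_Mapping.keys v \<subseteq> carrier M \<times> carrier N" "V = ?K #>\<^bsub>?G\<^esub> v"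
    using U V by (auto simp: tensor_def FactGroup_def RCOSETS_def)
  have "u \<in> U"
    using G.rcos_self[OF _ K] u by simp
  then have "?F u \<in> tensor_map R M' N' g f U"
    using tensor_subgroup_zero[OF M' N'] by (force simp: tensor_map_def r_coset_def)
  \<comment> \<open>Equality of the unions yields only some representative \<open>v'\<close> of
    \<open>V\<close>; its deviation \<open>k\<close> from \<open>v\<close> is added back
    below.\<close>
  then obtain v' k' where v': "v' \<in> V" and k': "k' \<in> ?K'" and Fu: "?F u = k' + ?F v'"
    unfolding eq by (auto simp: tensor_map_def r_coset_def)
  obtain k where k: "k \<in> ?K" and v'_eq: "v' = k + v"
    using v' v by (auto simp: r_coset_def)
  have "?F (u - v') = k'"
    using Fu by (simp add: frag_extend_diff)
  then have "u - v' \<in> ?K"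
    using k' u v tensor_subgroup_keys[OF M N k] v'_eq
    by (intro reflects) (auto dest!: subsetD[OF keys_diff] subsetD[OF keys_add])
  then have "(u - v') + k \<in> ?K"
    using k by (rule tensor_subgroup_add[OF M N])
  then have "u \<in> V"
    using v v'_eq by (auto simp: r_coset_def intro!: bexI[of _ "(u - v') + k"])
  then show "U = V"
    using G.repr_independence[OF _ _ K, of u v] u v by simp
qed

text \<open>Swapping interchanges the two families of additivity relators and sends a balancing
  relator to the negative of one. No opposite ring appears, because the relators never mention
  multiplication of scalars.\<close>

lemma tensor_subgroup_swap:
  assumes M: "distributive_action R M" and N: "distributive_action R N"
    and a: "a \<in> tensor_subgroup R M N"
  shows "frag_extend (frag_of \<circ> prod.swap) a \<in> tensor_subgroup R N M"
proof -
  let ?s = "frag_extend (frag_of \<circ> prod.swap)"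
  have rel: "?s a \<in> tensor_subgroup R N M" if "a \<in> tensor_relators R M N" for a
    using that unfolding tensor_relators_def
    apply (auto simp: frag_extend_diff intro: tensor_relator_left[OF N M] tensor_relator_right[OF N M])
    by (metis tensor_relator_balanced[OF N M] tensor_subgroup_minus[OF N M] minus_diff_eq)
  from a show ?thesis
    unfolding tensor_subgroup_def[of R M N]
  proof (induction a rule: generate.induct)
    case (inv a)
    then have "a \<in> carrier (free_Abelian_group (carrier M \<times> carrier N))"
      using tensor_relators_closed[OF M N] by blast
    then show ?case using tensor_subgroup_minus[OF N M rel[OF inv]]
      by (simp add: frag_extend_minus[of "frag_of \<circ> prod.swap"] del: comp_apply)
  qed (simp_all add: rel[unfolded comp_def] rel frag_extend_add tensor_subgroup_zero[OF N M] tensor_subgroup_add[OF N M])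
qed

text \<open>
  The functionals \<open>p k\<close> are linear into \<open>R\<close> for \<open>\<mu> a r = a \<otimes> r\<close> on a right module and for
  \<open>\<mu> a r = r \<otimes> a\<close> on a left module.
\<close>

definition coordinate_system ::
  "('r, 'a) ring_scheme \<Rightarrow> ('r, 'm, 'b) module_scheme \<Rightarrow> ('r \<Rightarrow> 'r \<Rightarrow> 'r) \<Rightarrow> 'm set
    \<Rightarrow> 'i set \<Rightarrow> ('i \<Rightarrow> 'm) \<Rightarrow> ('i \<Rightarrow> 'm \<Rightarrow> 'r) \<Rightarrow> bool"
  where "coordinate_system R M \<mu> B I w p \<longleftrightarrow> finite I \<and>
    (\<forall>k\<in>I. w k \<in> carrier M) \<and>
    (\<forall>k\<in>I. \<forall>x\<in>carrier M. p k x \<in> carrier R) \<and>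
    (\<forall>k\<in>I. \<forall>x\<in>carrier M. \<forall>x'\<in>carrier M. p k (x \<oplus>\<^bsub>M\<^esub> x') = p k x \<oplus>\<^bsub>R\<^esub> p k x') \<and>
    (\<forall>k\<in>I. \<forall>r\<in>carrier R. \<forall>x\<in>carrier M. p k (r \<odot>\<^bsub>M\<^esub> x) = \<mu> (p k x) r) \<and>
    (\<forall>x\<in>B. x = finsum M (\<lambda>k. p k x \<odot>\<^bsub>M\<^esub> w k) I)"

text \<open>The formal element \<open>t\<close> has only finitely many first entries, and a
  coordinate system for these suffices. The law for \<open>\<mu>\<close> converts linearity of the
  functionals into the balancing needed on the test module.\<close>

lemma tensor_subgroup_reflects_coordinates:
  fixes R :: "('r, 'a) ring_scheme" and M :: "('r, 'm, 'b) module_scheme"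
    and N :: "('r, 'n, 'c) module_scheme" and N' :: "('r, 'l, 'd) module_scheme"
  assumes actions: "distributive_action R M" "distributive_action R N" "distributive_action R N'"
    and f: "f \<in> mod_hom R N N'" "inj_on f (carrier N)"
    and coords: "\<And>B. \<lbrakk>finite B; B \<subseteq> carrier M\<rbrakk>
      \<Longrightarrow> \<exists>(I :: 'i set) w p. coordinate_system R M \<mu> B I w p"
    and \<mu>: "\<And>a r y. \<lbrakk>a \<in> carrier R; r \<in> carrier R; y \<in> carrier N'\<rbrakk>
      \<Longrightarrow> \<mu> a r \<odot>\<^bsub>N'\<^esub> y = a \<odot>\<^bsub>N'\<^esub> (r \<odot>\<^bsub>N'\<^esub> y)"
    and t: "Poly_Mapping.keys t \<subseteq> carrier M \<times> carrier N"
    and image: "frag_extend (\<lambda>(x, y). frag_of (x, f y)) t \<in> tensor_subgroup R M N'"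
  shows "t \<in> tensor_subgroup R M N"
proof -
  let ?B = "fst ` Poly_Mapping.keys t"
  have B: "?B \<subseteq> carrier M" "Poly_Mapping.keys t \<subseteq> ?B \<times> carrier N"
    using t by force+
  obtain I :: "'i set" and w p where "coordinate_system R M \<mu> ?B I w p"
    using coords[OF _ B(1)] by auto
  then show ?thesis
    unfolding coordinate_system_def
    by (intro tensor_subgroup_reflects[OF actions f _ _ _ _ _ B(1) _ B(2) image,
          where I = I and w = w and p = p])
      (auto simp: \<mu>)
qed

lemma flat_right_moduleI:
  fixes R :: "('r, 'a) ring_scheme" and M :: "('r, 'm, 'b) module_scheme"
  assumes M: "right_module R M"
    and coords: "\<And>B. \<lbrakk>finite B; B \<subseteq> carrier M\<rbrakk>
      \<Longrightarrow> \<exists>(I :: 'i set) w p. coordinate_system R M (\<lambda>a r. a \<otimes>\<^bsub>R\<^esub> r) B I w p"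
  shows "flat_right_module TYPE('n1) TYPE('n2) R M"
  unfolding flat_right_module_def
proof (intro conjI allI impI M)
  fix N :: "('r, 'n1) module" and N' :: "('r, 'n2) module" and f
  assume "left_module R N \<and> left_module R N' \<and> f \<in> mod_hom R N N' \<and> inj_on f (carrier N)"
  then have N: "left_module R N" and N': "left_module R N'"
    and f: "f \<in> mod_hom R N N'" "inj_on f (carrier N)"
    by auto
  note actions = right_module_action[OF M] left_module_action[OF N] left_module_action[OF N']
  show "inj_on (tensor_map R M N' (\<lambda>x. x) f) (carrier (tensor R M N))"
    using left_module.smult_assoc[OF N']
    by (intro inj_on_tensor_map[OF actions(1,2,1,3)]
        tensor_subgroup_reflects_coordinates[OF actions f coords])
qed

text \<open>After a swap the module stands in the first factor as before. Acting by \<open>r\<close>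
  and then by \<open>a\<close> on a right module is acting by the product with \<open>r\<close> on
  the left, hence the order in \<open>\<mu>\<close>.\<close>

lemma flat_left_moduleI:
  fixes R :: "('r, 'a) ring_scheme" and M :: "('r, 'm, 'b) module_scheme"
  assumes M: "left_module R M"
    and coords: "\<And>B. \<lbrakk>finite B; B \<subseteq> carrier M\<rbrakk>
      \<Longrightarrow> \<exists>(I :: 'i set) w p. coordinate_system R M (\<lambda>a r. r \<otimes>\<^bsub>R\<^esub> a) B I w p"
  shows "flat_left_module TYPE('n1) TYPE('n2) R M"
  unfolding flat_left_module_def
proof (intro conjI allI impI M)
  fix N :: "('r, 'n1) module" and N' :: "('r, 'n2) module" and f
  assume "right_module R N \<and> right_module R N' \<and> f \<in> mod_hom R N N' \<and> inj_on f (carrier N)"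
  then have N: "right_module R N" and N': "right_module R N'"
    and f: "f \<in> mod_hom R N N'" "inj_on f (carrier N)"
    by auto
  note actions = left_module_action[OF M] right_module_action[OF N] right_module_action[OF N']
  show "inj_on (tensor_map R N' M f (\<lambda>x. x)) (carrier (tensor R N M))"
  proof (rule inj_on_tensor_map[OF actions(2,1,3,1)])
    fix t
    assume t: "Poly_Mapping.keys t \<subseteq> carrier N \<times> carrier M"
      and image: "frag_extend (\<lambda>(x, y). frag_of (f x, y)) t \<in> tensor_subgroup R N' M"
    let ?s = "frag_extend (frag_of \<circ> prod.swap)"
    have maps: "(\<lambda>(x, y). frag_of (f x, y)) = frag_of \<circ> map_prod f id"
      "(\<lambda>(x, y). frag_of (x, f y)) = frag_of \<circ> map_prod id f"
      by auto
    \<comment> \<open>Swapping commutes with applying \<open>f\<close> in its slot, so the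
      hypothesis on the image can be transported; since swapping is an involution, the conclusion
      can be carried back.\<close>
    have "?s (frag_extend (frag_of \<circ> map_prod f id) t)
        = frag_extend (frag_of \<circ> map_prod id f) (?s t)"
      unfolding frag_extend_compose
      by (rule frag_extend_eq) (auto simp: comp_def)
    then have "frag_extend (\<lambda>(x, y). frag_of (x, f y)) (?s t) \<in> tensor_subgroup R M N'"
      using tensor_subgroup_swap[OF actions(3,1) image] by (simp add: maps)
    moreover have "Poly_Mapping.keys (?s t) \<subseteq> carrier M \<times> carrier N"
      using t by (intro order_trans[OF keys_frag_extend]) auto
    ultimately have "?s t \<in> tensor_subgroup R M N"
      using right_module.smult_assoc[OF N']
      by (intro tensor_subgroup_reflects_coordinates[OF actions f coords])
    from tensor_subgroup_swap[OF actions(1,2) this] show "t \<in> tensor_subgroup R N M"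
      by (simp add: frag_extend_compose comp_assoc flip: frag_expansion)
  qed
qed

section \<open>Relations of bounded degree\<close>

text \<open>The sparsity condition of the cone, stated for positions instead of entries so that
  supports of several matrices can be united.\<close>

definition bounded_degree :: "(nat \<times> nat) set \<Rightarrow> bool" where
  "bounded_degree S \<longleftrightarrow> (\<exists>n. (\<forall>i. finite {j. (i, j) \<in> S} \<and> card {j. (i, j) \<in> S} \<le> n) \<and>
                           (\<forall>j. finite {i. (i, j) \<in> S} \<and> card {i. (i, j) \<in> S} \<le> n))"

lemma bounded_degree_mono:
  assumes "bounded_degree S" "T \<subseteq> S"
  shows "bounded_degree T"
proof -
  obtain n where n: "\<And>i. finite {j. (i, j) \<in> S} \<and> card {j. (i, j) \<in> S} \<le> n"
    "\<And>j. finite {i. (i, j) \<in> S} \<and> card {i. (i, j) \<in> S} \<le> n"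
    using assms unfolding bounded_degree_def by blast
  have "{j. (i, j) \<in> T} \<subseteq> {j. (i, j) \<in> S}" "{j. (j, i) \<in> T} \<subseteq> {j. (j, i) \<in> S}" for i
    using assms(2) by auto
  with n show ?thesis
    unfolding bounded_degree_def by (meson card_mono finite_subset order_trans)
qed

lemma bounded_degree_Un:
  assumes "bounded_degree S" "bounded_degree T"
  shows "bounded_degree (S \<union> T)"
proof -
  obtain m where m: "\<And>i. finite {j. (i, j) \<in> S} \<and> card {j. (i, j) \<in> S} \<le> m"
    "\<And>j. finite {i. (i, j) \<in> S} \<and> card {i. (i, j) \<in> S} \<le> m"
    using assms unfolding bounded_degree_def by blast
  obtain n where n: "\<And>i. finite {j. (i, j) \<in> T} \<and> card {j. (i, j) \<in> T} \<le> n"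
    "\<And>j. finite {i. (i, j) \<in> T} \<and> card {i. (i, j) \<in> T} \<le> n"
    using assms unfolding bounded_degree_def by blast
  have "card {j. (i, j) \<in> S \<union> T} \<le> m + n" "card {j. (j, i) \<in> S \<union> T} \<le> m + n" for i
  proof -
    show "card {j. (i, j) \<in> S \<union> T} \<le> m + n"
      using card_Un_le[of "{j. (i, j) \<in> S}" "{j. (i, j) \<in> T}"] m(1)[of i] n(1)[of i]
      by (simp add: Collect_disj_eq)
    show "card {j. (j, i) \<in> S \<union> T} \<le> m + n"
      using card_Un_le[of "{j. (j, i) \<in> S}" "{j. (j, i) \<in> T}"] m(2)[of i] n(2)[of i]
      by (simp add: Collect_disj_eq)
  qed
  moreover have "finite {j. (i, j) \<in> S \<union> T}" "finite {j. (j, i) \<in> S \<union> T}" for i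
    using m n by (simp_all add: Collect_disj_eq)
  ultimately show ?thesis
    unfolding bounded_degree_def by (intro exI[of _ "m + n"]) simp
qed

lemma bounded_degree_converse: "bounded_degree S \<Longrightarrow> bounded_degree (S\<inverse>)"
  unfolding bounded_degree_def by (simp add: conj_commute)

lemma bounded_degree_UN:
  assumes "finite A" "\<And>x. x \<in> A \<Longrightarrow> bounded_degree (S x)"
  shows "bounded_degree (\<Union>x\<in>A. S x)"
  using assms
proof (induction A)
  case empty
  show ?case by (simp add: bounded_degree_def)
next
  case (insert x A)
  then show ?case by (simp add: bounded_degree_Un)
qed

text \<open>Strictness comes from \<open>j\<close> itself, counted only on the right; both sets are
  bounded, hence finite even for infinite \<open>J\<close>.\<close>

lemma card_below_less:
  fixes j j' :: nat
  assumes "j \<in> J" "j < j'"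
  shows "card {l \<in> J. l < j} < card {l \<in> J. l < j'}"
  using assms by (intro psubset_card_mono) auto

text \<open>
  Labelling each entry by its rank within its row and its rank within its column is an edge colouring
  that, unlike a greedy one, needs no recursion.
\<close>

definition entry_label :: "(nat \<times> nat) set \<Rightarrow> nat \<Rightarrow> nat \<Rightarrow> nat \<times> nat" where
  "entry_label S i j = (card {l. (i, l) \<in> S \<and> l < j}, card {l. (l, j) \<in> S \<and> l < i})"

lemma entry_label_row_inj:
  assumes "(i, j) \<in> S" "(i, j') \<in> S" "entry_label S i j = entry_label S i j'"
  shows "j = j'"
  using card_below_less[of j "{l. (i, l) \<in> S}" j'] card_below_less[of j' "{l. (i, l) \<in> S}" j] assms
  by (cases j j' rule: linorder_cases) (auto simp: entry_label_def)

lemma entry_label_column_inj: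
  assumes "(i, j) \<in> S" "(i', j) \<in> S" "entry_label S i j = entry_label S i' j"
  shows "i = i'"
  using card_below_less[of i "{l. (l, j) \<in> S}" i'] card_below_less[of i' "{l. (l, j) \<in> S}" i] assms
  by (cases i i' rule: linorder_cases) (auto simp: entry_label_def)

definition matching :: "(nat \<times> nat) set \<Rightarrow> bool" where
  "matching G \<longleftrightarrow> (\<forall>i j j'. (i, j) \<in> G \<longrightarrow> (i, j') \<in> G \<longrightarrow> j = j') \<and>
                 (\<forall>i i' j. (i, j) \<in> G \<longrightarrow> (i', j) \<in> G \<longrightarrow> i = i')"

lemma bounded_degree_matching:
  assumes "matching G"
  shows "bounded_degree G"
proof -
  have "finite {j. (i, j) \<in> G} \<and> card {j. (i, j) \<in> G} \<le> 1"
    "finite {j. (j, i) \<in> G} \<and> card {j. (j, i) \<in> G} \<le> 1" for i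
  proof -
    \<comment> \<open>If nothing is related to \<open>i\<close>, the inclusion is trivial whatever
      \<open>THE\<close> denotes.\<close>
    have "{j. (i, j) \<in> G} \<subseteq> {THE j. (i, j) \<in> G}" "{j. (j, i) \<in> G} \<subseteq> {THE j. (j, i) \<in> G}"
      using assms by (auto simp: matching_def intro!: the_equality[symmetric])
    then show "finite {j. (i, j) \<in> G} \<and> card {j. (i, j) \<in> G} \<le> 1"
      "finite {j. (j, i) \<in> G} \<and> card {j. (j, i) \<in> G} \<le> 1"
      by (auto dest: finite_subset card_mono[rotated])
  qed
  then show ?thesis unfolding bounded_degree_def by blast
qed

text \<open>Entries in a common row or column carry different labels, so each label class is a
  matching. Ranks are bounded by the degree bound \<open>n\<close>, leaving at most (n + 1)^2
  labels; this is wasteful as an edge colouring, but only finiteness matters.\<close>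

lemma bounded_degree_partition:
  assumes "bounded_degree S"
  obtains I :: "(nat \<times> nat) set" and G
  where "finite I" "\<And>k. k \<in> I \<Longrightarrow> matching (G k)"
    "\<And>i j. (i, j) \<in> S \<Longrightarrow> \<exists>!k. k \<in> I \<and> (i, j) \<in> G k"
proof -
  obtain n where n: "\<And>i. finite {j. (i, j) \<in> S} \<and> card {j. (i, j) \<in> S} \<le> n"
    "\<And>j. finite {i. (i, j) \<in> S} \<and> card {i. (i, j) \<in> S} \<le> n"
    using assms unfolding bounded_degree_def by blast
  define G where "G k = {(i, j). (i, j) \<in> S \<and> entry_label S i j = k}" for k
  show thesis
  proof (rule that[of "{..n} \<times> {..n}" G])
    show "finite ({..n} \<times> {..n})" by simp
    show "matching (G k)" for k
      unfolding matching_def G_def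
      using entry_label_row_inj[of _ _ S] entry_label_column_inj[of _ _ S] by fastforce
    show "\<exists>!k. k \<in> {..n} \<times> {..n} \<and> (i, j) \<in> G k" if "(i, j) \<in> S" for i j
    proof -
      have "card {l. (i, l) \<in> S \<and> l < j} \<le> card {l. (i, l) \<in> S}"
        "card {l. (l, j) \<in> S \<and> l < i} \<le> card {l. (l, j) \<in> S}"
        using n by (auto intro!: card_mono)
      then have "entry_label S i j \<in> {..n} \<times> {..n}"
        using n by (auto simp: entry_label_def intro: order_trans)
      then show ?thesis using that by (auto simp: G_def)
    qed
  qed
qed

section \<open>Karoubi's cone as a module over the finite-valued sequences\<close>

definition matrix_support :: "('a, 'b) ring_scheme \<Rightarrow> (nat \<Rightarrow> nat \<Rightarrow> 'a) \<Rightarrow> (nat \<times> nat) set" where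
  "matrix_support R A = {(i, j). A i j \<noteq> \<zero>\<^bsub>R\<^esub>}"

lemma karoubi_matrices_iff:
  "A \<in> karoubi_matrices R \<longleftrightarrow>
     (\<forall>i j. A i j \<in> carrier R) \<and> finite (range (case_prod A)) \<and> bounded_degree (matrix_support R A)"
proof -
  have "{A i j | i j. True} = range (case_prod A)" by auto
  then show ?thesis
    by (simp add: karoubi_matrices_def bounded_degree_def matrix_support_def)
qed

text \<open>Cancellation and zero divisors make the exact entries and support of a sum or multiple
  hard to name; overestimates of both are enough.\<close>

lemma karoubi_matricesI:
  assumes "\<And>i j. C i j \<in> carrier R" and "finite F" "\<And>i j. C i j \<in> F"
    and "bounded_degree S" "\<And>i j. C i j \<noteq> \<zero>\<^bsub>R\<^esub> \<Longrightarrow> (i, j) \<in> S"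
  shows "C \<in> karoubi_matrices R"
proof -
  have "range (case_prod C) \<subseteq> F" "matrix_support R C \<subseteq> S"
    using assms by (auto simp: matrix_support_def)
  then show ?thesis
    using assms(1) finite_subset[OF _ assms(2)] bounded_degree_mono[OF assms(4)]
    by (simp add: karoubi_matrices_iff)
qed

lemma diag_matrix_cone_mult:
  fixes R (structure)
  assumes "ring R" "\<And>i. \<alpha> i \<in> carrier R" "\<And>i j. A i j \<in> carrier R"
  shows "diag_matrix R \<alpha> \<otimes>\<^bsub>Karoubi_cone R\<^esub> A = (\<lambda>i j. \<alpha> i \<otimes> A i j)" (is ?left)
    and "A \<otimes>\<^bsub>Karoubi_cone R\<^esub> diag_matrix R \<alpha> = (\<lambda>i j. A i j \<otimes> \<alpha> j)" (is ?right)
proof -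
  interpret ring R by fact
  show ?left
  proof (intro ext)
    fix i j
    let ?g = "\<lambda>k. diag_matrix R \<alpha> i k \<otimes> A k j"
    \<comment> \<open>The restricted index set can be empty even though the diagonal meets it,
      namely when the one relevant product is zero; the empty sum then has the right value.\<close>
    have "{k. ?g k \<noteq> \<zero>} = (if \<alpha> i \<otimes> A i j = \<zero> then {} else {i})"
      using assms by (auto simp: diag_matrix_def split: if_splits)
    then show "(diag_matrix R \<alpha> \<otimes>\<^bsub>Karoubi_cone R\<^esub> A) i j = \<alpha> i \<otimes> A i j"
      using assms by (simp add: Karoubi_cone_def) (simp add: diag_matrix_def)
  qed
  show ?right
  proof (intro ext)
    fix i j
    let ?g = "\<lambda>k. A i k \<otimes> diag_matrix R \<alpha> k j"
    have "{k. ?g k \<noteq> \<zero>} = (if A i j \<otimes> \<alpha> j = \<zero> then {} else {j})"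
      using assms by (auto simp: diag_matrix_def split: if_splits)
    then show "(A \<otimes>\<^bsub>Karoubi_cone R\<^esub> diag_matrix R \<alpha>) i j = A i j \<otimes> \<alpha> j"
      using assms by (simp add: Karoubi_cone_def) (simp add: diag_matrix_def)
  qed
qed

context
  fixes R :: "('a, 'b) ring_scheme" (structure)
  assumes ring: "ring R"
begin

interpretation ring R by (fact ring)

abbreviation (input) "seqs \<equiv> finite_valued_sequences R"
abbreviation (input) "left_cone \<equiv> left_restrict_scalars (diag_matrix R) (Karoubi_cone R)"
abbreviation (input) "right_cone \<equiv> right_restrict_scalars (diag_matrix R) (Karoubi_cone R)"

section \<open>Entrywise algebra of sequences and matrices\<close>

lemma finite_valued_sequences_op:
  assumes "\<alpha> \<in> carrier seqs" "\<beta> \<in> carrier seqs"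
    and "\<And>x y. \<lbrakk>x \<in> carrier R; y \<in> carrier R\<rbrakk> \<Longrightarrow> f x y \<in> carrier R"
  shows "(\<lambda>i. f (\<alpha> i) (\<beta> i)) \<in> carrier seqs"
proof -
  have "range (\<lambda>i. f (\<alpha> i) (\<beta> i)) \<subseteq> case_prod f ` (range \<alpha> \<times> range \<beta>)"
    by auto
  moreover have "finite (case_prod f ` (range \<alpha> \<times> range \<beta>))"
    using assms(1,2) by (simp add: finite_valued_sequences_def)
  ultimately have "finite (range (\<lambda>i. f (\<alpha> i) (\<beta> i)))"
    by (rule finite_subset)
  then show ?thesis
    using assms by (simp add: finite_valued_sequences_def image_subset_iff)
qed

lemma ring_finite_valued_sequences: "ring seqs"
proof (intro ringI abelian_groupI monoidI)
  fix x assume x: "x \<in> carrier seqs"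
  show "\<exists>y\<in>carrier seqs. y \<oplus>\<^bsub>seqs\<^esub> x = \<zero>\<^bsub>seqs\<^esub>"
  proof
    show "(\<lambda>i. \<ominus> x i) \<in> carrier seqs"
      using finite_valued_sequences_op[OF x x, of "\<lambda>u v. \<ominus> u"] by simp
    show "(\<lambda>i. \<ominus> x i) \<oplus>\<^bsub>seqs\<^esub> x = \<zero>\<^bsub>seqs\<^esub>"
      using x by (auto simp: finite_valued_sequences_def l_neg range_subsetD)
  qed
next
  fix x y assume "x \<in> carrier seqs" "y \<in> carrier seqs"
  then show "x \<oplus>\<^bsub>seqs\<^esub> y \<in> carrier seqs" "x \<otimes>\<^bsub>seqs\<^esub> y \<in> carrier seqs"
    using finite_valued_sequences_op[of x y "(\<oplus>)"] finite_valued_sequences_op[of x y "(\<otimes>)"]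
    by (simp_all add: finite_valued_sequences_def)
next
  fix x y assume "x \<in> carrier seqs" "y \<in> carrier seqs"
  then show "x \<oplus>\<^bsub>seqs\<^esub> y = y \<oplus>\<^bsub>seqs\<^esub> x"
    by (simp add: finite_valued_sequences_def range_subsetD a_comm)
qed (simp_all add: finite_valued_sequences_def range_subsetD a_assoc m_assoc l_distr r_distr)

lemma karoubi_matrices_add:
  assumes "A \<in> karoubi_matrices R" "B \<in> karoubi_matrices R"
  shows "(\<lambda>i j. A i j \<oplus> B i j) \<in> karoubi_matrices R"
proof (rule karoubi_matricesI)
  show "finite (case_prod (\<oplus>) ` (range (case_prod A) \<times> range (case_prod B)))"
    using assms by (simp add: karoubi_matrices_iff)
  show "A i j \<oplus> B i j \<in> case_prod (\<oplus>) ` (range (case_prod A) \<times> range (case_prod B))" for i j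
    by (rule image_eqI[of _ _ "(A i j, B i j)"]) auto
  show "bounded_degree (matrix_support R A \<union> matrix_support R B)"
    using assms by (simp add: karoubi_matrices_iff bounded_degree_Un)
  show "A i j \<oplus> B i j \<in> carrier R" for i j
    using assms by (simp add: karoubi_matrices_iff)
  show "(i, j) \<in> matrix_support R A \<union> matrix_support R B" if "A i j \<oplus> B i j \<noteq> \<zero>" for i j
    using that by (auto simp: matrix_support_def)
qed

text \<open>The index \<open>l i j\<close> selects the row for the left action and the column for
  the right one, while \<open>f\<close> fixes the order of the factors; negation is the case in
  which \<open>f\<close> ignores the scalar. Preservation of zero keeps the support from
  growing.\<close>

lemma karoubi_matrices_scale:
  assumes A: "A \<in> karoubi_matrices R" and \<alpha>: "\<alpha> \<in> carrier seqs"
    and f: "\<And>x y. \<lbrakk>x \<in> carrier R; y \<in> carrier R\<rbrakk> \<Longrightarrow> f x y \<in> carrier R"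
    and f0: "\<And>x. x \<in> carrier R \<Longrightarrow> f x \<zero> = \<zero>"
  shows "(\<lambda>i j. f (\<alpha> (l i j)) (A i j)) \<in> karoubi_matrices R"
proof (rule karoubi_matricesI)
  have \<alpha>': "\<alpha> i \<in> carrier R" "finite (range \<alpha>)" for i
    using \<alpha> by (auto simp: finite_valued_sequences_def)
  show "finite (case_prod f ` (range \<alpha> \<times> range (case_prod A)))"
    using A \<alpha>' by (simp add: karoubi_matrices_iff)
  show "f (\<alpha> (l i j)) (A i j) \<in> case_prod f ` (range \<alpha> \<times> range (case_prod A))" for i j
    by (rule image_eqI[of _ _ "(\<alpha> (l i j), A i j)"]) auto
  show "bounded_degree (matrix_support R A)"
    using A by (simp add: karoubi_matrices_iff)
  show "f (\<alpha> (l i j)) (A i j) \<in> carrier R" for i j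
    using A \<alpha>' f by (simp add: karoubi_matrices_iff)
  show "(i, j) \<in> matrix_support R A" if "f (\<alpha> (l i j)) (A i j) \<noteq> \<zero>" for i j
    using that f0 \<alpha>' by (auto simp: matrix_support_def)
qed

lemma abelian_group_Karoubi_cone: "abelian_group (Karoubi_cone R)"
proof (rule abelian_groupI)
  show "\<zero>\<^bsub>Karoubi_cone R\<^esub> \<in> carrier (Karoubi_cone R)"
    unfolding Karoubi_cone_def ring_record_simps partial_object.select_convs
    by (rule karoubi_matricesI[where F = "{\<zero>}" and S = "{}"]) (simp_all add: bounded_degree_def)
next
  fix x assume x: "x \<in> carrier (Karoubi_cone R)"
  show "\<exists>y\<in>carrier (Karoubi_cone R). y \<oplus>\<^bsub>Karoubi_cone R\<^esub> x = \<zero>\<^bsub>Karoubi_cone R\<^esub>"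
  proof
    show "(\<lambda>i j. \<ominus> x i j) \<in> carrier (Karoubi_cone R)"
      using karoubi_matrices_scale[of x "\<lambda>_. \<zero>" "\<lambda>u v. \<ominus> v"] x
      by (simp add: Karoubi_cone_def finite_valued_sequences_def)
    show "(\<lambda>i j. \<ominus> x i j) \<oplus>\<^bsub>Karoubi_cone R\<^esub> x = \<zero>\<^bsub>Karoubi_cone R\<^esub>"
      using x by (auto simp: Karoubi_cone_def karoubi_matrices_iff l_neg)
  qed
next
  fix x y assume "x \<in> carrier (Karoubi_cone R)" "y \<in> carrier (Karoubi_cone R)"
  then show "x \<oplus>\<^bsub>Karoubi_cone R\<^esub> y \<in> carrier (Karoubi_cone R)"
    "x \<oplus>\<^bsub>Karoubi_cone R\<^esub> y = y \<oplus>\<^bsub>Karoubi_cone R\<^esub> x"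
    by (simp_all add: Karoubi_cone_def karoubi_matrices_add, simp add: karoubi_matrices_iff a_comm)
qed (simp_all add: Karoubi_cone_def karoubi_matrices_iff a_assoc)

text \<open>Since the matrix product collapses for a diagonal factor, the module laws reduce to ring
  laws at each position.\<close>

lemma left_restrict_scalars_simps:
  "carrier left_cone = karoubi_matrices R" "\<zero>\<^bsub>left_cone\<^esub> = (\<lambda>_ _. \<zero>)" "A \<oplus>\<^bsub>left_cone\<^esub> B = (\<lambda>i j. A i j \<oplus> B i j)"
  "\<lbrakk>\<alpha> \<in> carrier seqs; A \<in> karoubi_matrices R\<rbrakk> \<Longrightarrow> \<alpha> \<odot>\<^bsub>left_cone\<^esub> A = (\<lambda>i j. \<alpha> i \<otimes> A i j)"
  using diag_matrix_cone_mult(1)[OF ring, of \<alpha> A]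
  by (auto simp: left_restrict_scalars_def Karoubi_cone_def finite_valued_sequences_def
      karoubi_matrices_iff)

lemma right_restrict_scalars_simps:
  "carrier right_cone = karoubi_matrices R" "\<zero>\<^bsub>right_cone\<^esub> = (\<lambda>_ _. \<zero>)" "A \<oplus>\<^bsub>right_cone\<^esub> B = (\<lambda>i j. A i j \<oplus> B i j)"
  "\<lbrakk>\<alpha> \<in> carrier seqs; A \<in> karoubi_matrices R\<rbrakk> \<Longrightarrow> \<alpha> \<odot>\<^bsub>right_cone\<^esub> A = (\<lambda>i j. A i j \<otimes> \<alpha> j)"
  using diag_matrix_cone_mult(2)[OF ring, of \<alpha> A]
  by (auto simp: right_restrict_scalars_def Karoubi_cone_def finite_valued_sequences_def
      karoubi_matrices_iff)

lemma abelian_group_restrict_scalars: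
  "abelian_group left_cone" "abelian_group right_cone"
  using abelian_groupE[OF abelian_group_Karoubi_cone]
  by (auto intro!: abelian_groupI simp: left_restrict_scalars_def right_restrict_scalars_def)

lemma finite_valued_sequences_simps:
  "\<alpha> \<oplus>\<^bsub>seqs\<^esub> \<beta> = (\<lambda>i. \<alpha> i \<oplus> \<beta> i)" "\<alpha> \<otimes>\<^bsub>seqs\<^esub> \<beta> = (\<lambda>i. \<alpha> i \<otimes> \<beta> i)" "\<one>\<^bsub>seqs\<^esub> = (\<lambda>_. \<one>)"
  by (simp_all add: finite_valued_sequences_def)

lemma finite_valued_sequences_entry: "\<alpha> \<in> carrier seqs \<Longrightarrow> \<alpha> i \<in> carrier R"
  by (auto simp: finite_valued_sequences_def)

lemma karoubi_matrices_entry: "A \<in> karoubi_matrices R \<Longrightarrow> A i j \<in> carrier R"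
  by (simp add: karoubi_matrices_iff)

section \<open>Module laws for the two actions on the cone\<close>

lemma left_module_Karoubi_cone: "left_module seqs left_cone"
proof -
  interpret seqs: ring seqs by (fact ring_finite_valued_sequences)
  note [simp] = left_restrict_scalars_simps
  have closed [simp]: "(\<lambda>i j. \<alpha> i \<otimes> A i j) \<in> karoubi_matrices R"
    if "\<alpha> \<in> carrier seqs" "A \<in> karoubi_matrices R" for \<alpha> A
    by (rule karoubi_matrices_scale[where l = "\<lambda>i j. i", OF that(2,1)]) auto
  show ?thesis
  proof (intro left_module.intro left_module_axioms.intro ring_finite_valued_sequences
      abelian_group_restrict_scalars)
    fix r A assume "r \<in> carrier seqs" "A \<in> carrier left_cone"
    then show "r \<odot>\<^bsub>left_cone\<^esub> A \<in> carrier left_cone"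
      by simp
  next
    fix r s A assume r: "r \<in> carrier seqs" and s: "s \<in> carrier seqs" and A: "A \<in> carrier left_cone"
    have entries: "r i \<in> carrier R" "s i \<in> carrier R" "A i j \<in> carrier R" for i j
      using r s A by (simp_all add: finite_valued_sequences_entry karoubi_matrices_entry)
    show "(r \<oplus>\<^bsub>seqs\<^esub> s) \<odot>\<^bsub>left_cone\<^esub> A = r \<odot>\<^bsub>left_cone\<^esub> A \<oplus>\<^bsub>left_cone\<^esub> s \<odot>\<^bsub>left_cone\<^esub> A"
      using r s A seqs.a_closed[OF r s] by (simp add: finite_valued_sequences_simps entries l_distr r_distr)
    show "(r \<otimes>\<^bsub>seqs\<^esub> s) \<odot>\<^bsub>left_cone\<^esub> A = r \<odot>\<^bsub>left_cone\<^esub> (s \<odot>\<^bsub>left_cone\<^esub> A)"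
      using r s A seqs.m_closed[OF r s] by (simp add: finite_valued_sequences_simps entries m_assoc)
  next
    fix r A B assume r: "r \<in> carrier seqs" and AB: "A \<in> carrier left_cone" "B \<in> carrier left_cone"
    have entries: "r i \<in> carrier R" "A i j \<in> carrier R" "B i j \<in> carrier R" for i j
      using r AB by (simp_all add: finite_valued_sequences_entry karoubi_matrices_entry)
    show "r \<odot>\<^bsub>left_cone\<^esub> (A \<oplus>\<^bsub>left_cone\<^esub> B) = r \<odot>\<^bsub>left_cone\<^esub> A \<oplus>\<^bsub>left_cone\<^esub> r \<odot>\<^bsub>left_cone\<^esub> B"
      using r AB by (simp add: karoubi_matrices_add entries l_distr r_distr)
  next
    fix A assume A: "A \<in> carrier left_cone"
    then have entries: "A i j \<in> carrier R" for i j
      by (simp add: karoubi_matrices_entry)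
    show "\<one>\<^bsub>seqs\<^esub> \<odot>\<^bsub>left_cone\<^esub> A = A"
      using A seqs.one_closed by (simp add: finite_valued_sequences_simps entries)
  qed
qed

lemma right_module_Karoubi_cone: "right_module seqs right_cone"
proof -
  interpret seqs: ring seqs by (fact ring_finite_valued_sequences)
  note [simp] = right_restrict_scalars_simps
  have closed [simp]: "(\<lambda>i j. A i j \<otimes> \<alpha> j) \<in> karoubi_matrices R"
    if "\<alpha> \<in> carrier seqs" "A \<in> karoubi_matrices R" for \<alpha> A
    by (rule karoubi_matrices_scale[where l = "\<lambda>i j. j" and f = "\<lambda>x y. y \<otimes> x", OF that(2,1)]) auto
  show ?thesis
  proof (intro right_module.intro right_module_axioms.intro ring_finite_valued_sequences
      abelian_group_restrict_scalars)
    fix r A assume "r \<in> carrier seqs" "A \<in> carrier right_cone"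
    then show "r \<odot>\<^bsub>right_cone\<^esub> A \<in> carrier right_cone"
      by simp
  next
    fix r s A assume r: "r \<in> carrier seqs" and s: "s \<in> carrier seqs" and A: "A \<in> carrier right_cone"
    have entries: "r i \<in> carrier R" "s i \<in> carrier R" "A i j \<in> carrier R" for i j
      using r s A by (simp_all add: finite_valued_sequences_entry karoubi_matrices_entry)
    show "(r \<oplus>\<^bsub>seqs\<^esub> s) \<odot>\<^bsub>right_cone\<^esub> A = r \<odot>\<^bsub>right_cone\<^esub> A \<oplus>\<^bsub>right_cone\<^esub> s \<odot>\<^bsub>right_cone\<^esub> A"
      using r s A seqs.a_closed[OF r s] by (simp add: finite_valued_sequences_simps entries l_distr r_distr)
    show "(r \<otimes>\<^bsub>seqs\<^esub> s) \<odot>\<^bsub>right_cone\<^esub> A = s \<odot>\<^bsub>right_cone\<^esub> (r \<odot>\<^bsub>right_cone\<^esub> A)"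
      using r s A seqs.m_closed[OF r s] by (simp add: finite_valued_sequences_simps entries m_assoc)
  next
    fix r A B assume r: "r \<in> carrier seqs" and AB: "A \<in> carrier right_cone" "B \<in> carrier right_cone"
    have entries: "r i \<in> carrier R" "A i j \<in> carrier R" "B i j \<in> carrier R" for i j
      using r AB by (simp_all add: finite_valued_sequences_entry karoubi_matrices_entry)
    show "r \<odot>\<^bsub>right_cone\<^esub> (A \<oplus>\<^bsub>right_cone\<^esub> B) = r \<odot>\<^bsub>right_cone\<^esub> A \<oplus>\<^bsub>right_cone\<^esub> r \<odot>\<^bsub>right_cone\<^esub> B"
      using r AB by (simp add: karoubi_matrices_add entries l_distr r_distr)
  next
    fix A assume A: "A \<in> carrier right_cone"
    then have entries: "A i j \<in> carrier R" for i j
      by (simp add: karoubi_matrices_entry)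
    show "\<one>\<^bsub>seqs\<^esub> \<odot>\<^bsub>right_cone\<^esub> A = A"
      using A seqs.one_closed by (simp add: finite_valued_sequences_simps entries)
  qed
qed

section \<open>Decomposition of matrices along matchings\<close>

lemma restricted_matrix:
  assumes "A \<in> karoubi_matrices R"
  shows "(\<lambda>i j. if (i, j) \<in> G then A i j else \<zero>) \<in> karoubi_matrices R"
proof (rule karoubi_matricesI)
  show "finite (insert \<zero> (range (case_prod A)))" and "bounded_degree (matrix_support R A)"
    using assms by (simp_all add: karoubi_matrices_iff)
  show "(if (i, j) \<in> G then A i j else \<zero>) \<in> insert \<zero> (range (case_prod A))" for i j
    by (auto intro: image_eqI[of _ _ "(i, j)"])
qed (use assms in \<open>auto simp: karoubi_matrices_entry matrix_support_def split: if_splits\<close>)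

lemma matching_matrix:
  assumes "matching G"
  shows "(\<lambda>i j. if (i, j) \<in> G then \<one> else \<zero>) \<in> karoubi_matrices R"
  by (rule karoubi_matricesI[OF _ _ _ bounded_degree_matching[OF assms], where F = "{\<zero>, \<one>}"])
    (auto split: if_splits)

text \<open>Sums in \<open>M\<close> are entrywise. At a position of the support exactly one summand
  contributes; elsewhere every summand is zero, however many \<open>G k\<close> contain the
  position. The module stays abstract so that both actions are covered.\<close>

lemma finsum_partition:
  fixes M :: "('c, nat \<Rightarrow> nat \<Rightarrow> 'a, 'd) module_scheme"
  assumes "abelian_group M" and M: "carrier M = karoubi_matrices R" "\<zero>\<^bsub>M\<^esub> = (\<lambda>_ _. \<zero>)"
      "\<And>A B. A \<oplus>\<^bsub>M\<^esub> B = (\<lambda>i j. A i j \<oplus> B i j)"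
    and I: "finite I" and A: "A \<in> karoubi_matrices R"
    and unique: "\<And>i j. (i, j) \<in> matrix_support R A \<Longrightarrow> \<exists>!k. k \<in> I \<and> (i, j) \<in> G k"
  shows "finsum M (\<lambda>k i j. if (i, j) \<in> G k then A i j else \<zero>) I = A"
proof -
  interpret M: abelian_group M by fact
  have pointwise: "finsum M a J i j = finsum R (\<lambda>k. a k i j) J"
    if "finite J" "a \<in> J \<rightarrow> karoubi_matrices R" for a i j and J :: "'e set"
    using that
  proof (induction J)
    case empty
    then show ?case by (simp add: M)
  next
    case (insert k J)
    moreover have "a \<in> J \<rightarrow> carrier M" "(\<lambda>k. a k i j) \<in> J \<rightarrow> carrier R" "a k i j \<in> carrier R"
      using insert.prems by (auto simp: M Pi_iff intro!: karoubi_matrices_entry)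
    ultimately show ?case by (simp add: M)
  qed
  have "finsum R (\<lambda>k. if (i, j) \<in> G k then A i j else \<zero>) I = A i j" for i j
  proof (cases "(i, j) \<in> matrix_support R A")
    case True
    then obtain k where k: "k \<in> I" "\<And>k'. k' \<in> I \<Longrightarrow> (i, j) \<in> G k' \<longleftrightarrow> k = k'"
      using unique by metis
    have "finsum R (\<lambda>k. if (i, j) \<in> G k then A i j else \<zero>) I
        = finsum R (\<lambda>k'. if k = k' then A i j else \<zero>) I"
      by (rule finsum_cong') (auto simp: k karoubi_matrices_entry[OF A])
    also have "\<dots> = A i j"
      by (rule finsum_singleton[OF k(1) I]) (simp add: karoubi_matrices_entry[OF A])
    finally show ?thesis .
  next
    case False
    then show ?thesis by (simp add: matrix_support_def cong: if_cong)
  qed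
  then show ?thesis
    by (intro ext) (simp add: pointwise[OF I] restricted_matrix[OF A])
qed

text \<open>Zero for rows that miss \<open>G\<close> is the default compatible with additivity and
  scaling, which must hold on the whole cone.\<close>

definition row_entry :: "(nat \<times> nat) set \<Rightarrow> (nat \<Rightarrow> nat \<Rightarrow> 'a) \<Rightarrow> nat \<Rightarrow> 'a" where
  "row_entry G A i = (if \<exists>j. (i, j) \<in> G then A i (THE j. (i, j) \<in> G) else \<zero>)"

lemma row_entry_eq: "\<lbrakk>matching G; (i, j) \<in> G\<rbrakk> \<Longrightarrow> row_entry G A i = A i j"
  unfolding row_entry_def matching_def by (metis the_equality)

text \<open>Apart from the default zero, all values are entries of \<open>A\<close>, so the finite
  entry set of a cone matrix gives finitely many values.\<close>

lemma row_entry_closed: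
  assumes "A \<in> karoubi_matrices R"
  shows "row_entry G A \<in> carrier seqs"
proof -
  have "range (row_entry G A) \<subseteq> insert \<zero> (range (case_prod A))"
    by (auto simp: row_entry_def intro: image_eqI[of _ _ "(_, _)"])
  moreover have "finite (insert \<zero> (range (case_prod A)))"
    using assms by (simp add: karoubi_matrices_iff)
  ultimately have "finite (range (row_entry G A))" by (rule finite_subset)
  then show ?thesis
    using assms by (auto simp: finite_valued_sequences_def row_entry_def karoubi_matrices_entry)
qed

lemma row_entry_add: "row_entry G (\<lambda>i j. A i j \<oplus> B i j) = (\<lambda>i. row_entry G A i \<oplus> row_entry G B i)"
  by (auto simp: row_entry_def)

text \<open>The second equation is meant for transposes, in which the column scaling of the right
  action becomes a row scaling with the scalar still on the right.\<close>

lemma row_entry_mult: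
  assumes "\<alpha> \<in> carrier seqs"
  shows "row_entry G (\<lambda>i j. \<alpha> i \<otimes> A i j) = (\<lambda>i. \<alpha> i \<otimes> row_entry G A i)"
    and "row_entry G (\<lambda>i j. A i j \<otimes> \<alpha> i) = (\<lambda>i. row_entry G A i \<otimes> \<alpha> i)"
  using finite_valued_sequences_entry[OF assms] by (auto simp: row_entry_def)

lemma karoubi_matrices_transpose:
  assumes "A \<in> karoubi_matrices R"
  shows "(\<lambda>i j. A j i) \<in> karoubi_matrices R"
proof (rule karoubi_matricesI)
  show "finite (range (case_prod A))" and "bounded_degree ((matrix_support R A)\<inverse>)"
    using assms by (simp_all add: karoubi_matrices_iff bounded_degree_converse)
  show "A j i \<in> range (case_prod A)" for i j
    by (rule image_eqI[of _ _ "(j, i)"]) auto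
qed (use assms in \<open>auto simp: karoubi_matrices_entry matrix_support_def\<close>)

lemma matching_converse: "matching G \<Longrightarrow> matching (G\<inverse>)"
  unfolding matching_def by blast

text \<open>The same \<open>w k\<close> must expand every matrix of \<open>B\<close>, so the union
  of the supports is partitioned rather than each support separately.\<close>

lemma supports_partition:
  assumes "finite B" "B \<subseteq> karoubi_matrices R"
  obtains I :: "(nat \<times> nat) set" and G
  where "finite I" "\<And>k. k \<in> I \<Longrightarrow> matching (G k)"
    "\<And>A i j. \<lbrakk>A \<in> B; (i, j) \<in> matrix_support R A\<rbrakk> \<Longrightarrow> \<exists>!k. k \<in> I \<and> (i, j) \<in> G k"
proof -
  have "bounded_degree (\<Union>A\<in>B. matrix_support R A)"
    using assms by (intro bounded_degree_UN) (auto simp: karoubi_matrices_iff)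
  then obtain I :: "(nat \<times> nat) set" and G where "finite I" "\<And>k. k \<in> I \<Longrightarrow> matching (G k)"
    and "\<And>i j. (i, j) \<in> (\<Union>A\<in>B. matrix_support R A) \<Longrightarrow> \<exists>!k. k \<in> I \<and> (i, j) \<in> G k"
    using bounded_degree_partition by blast
  then show thesis
    by (intro that[of I G]) blast+
qed

lemma left_coordinates:
  assumes "finite B" "B \<subseteq> carrier left_cone"
  shows "\<exists>(I :: (nat \<times> nat) set) w p. coordinate_system seqs left_cone (\<lambda>a r. r \<otimes>\<^bsub>seqs\<^esub> a) B I w p"
proof -
  have B: "B \<subseteq> karoubi_matrices R" using assms(2) by (simp add: left_restrict_scalars_simps)
  obtain I :: "(nat \<times> nat) set" and G where I: "finite I"
    and G: "\<And>k. k \<in> I \<Longrightarrow> matching (G k)"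
    and unique: "\<And>A i j. \<lbrakk>A \<in> B; (i, j) \<in> matrix_support R A\<rbrakk> \<Longrightarrow> \<exists>!k. k \<in> I \<and> (i, j) \<in> G k"
    by (rule supports_partition[OF assms(1) B]) blast
  let ?w = "\<lambda>k i j. if (i, j) \<in> G k then \<one> else \<zero>" and ?p = "\<lambda>k. row_entry (G k)"
  note simps = left_restrict_scalars_simps finite_valued_sequences_simps matching_matrix G
    row_entry_closed row_entry_add row_entry_mult
  have expand: "A = finsum left_cone (\<lambda>k. ?p k A \<odot>\<^bsub>left_cone\<^esub> ?w k) I" if A: "A \<in> B" for A
  proof -
    have AK: "A \<in> karoubi_matrices R" using A B by blast
    have "finsum left_cone (\<lambda>k. ?p k A \<odot>\<^bsub>left_cone\<^esub> ?w k) I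
        = finsum left_cone (\<lambda>k i j. if (i, j) \<in> G k then A i j else \<zero>) I"
    proof (rule abelian_monoid.finsum_cong'[OF _ refl])
      \<comment> \<open>On \<open>G k\<close> the matching identifies the row coordinate with
        \<open>A i j\<close>; off \<open>G k\<close> the zero of \<open>?w k\<close> discards
        whatever coordinate the row has.\<close>
      show "?p k A \<odot>\<^bsub>left_cone\<^esub> ?w k = (\<lambda>i j. if (i, j) \<in> G k then A i j else \<zero>)" if "k \<in> I" for k
        using finite_valued_sequences_entry[OF row_entry_closed[OF AK]]
        by (simp add: simps AK that) (auto simp: fun_eq_iff row_entry_eq[OF G[OF that]]
            karoubi_matrices_entry[OF AK])
    qed (use abelian_group_restrict_scalars in
        \<open>auto simp: left_restrict_scalars_simps restricted_matrix AK abelian_group_def\<close>)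
    also have "\<dots> = A"
      by (rule finsum_partition[OF abelian_group_restrict_scalars(1)])
        (auto simp: left_restrict_scalars_simps I AK unique[OF A])
    finally show ?thesis by (rule sym)
  qed
  have "coordinate_system seqs left_cone (\<lambda>a r. r \<otimes>\<^bsub>seqs\<^esub> a) B I ?w ?p"
    unfolding coordinate_system_def
    by (intro conjI ballI I expand) (simp_all add: simps)
  then show ?thesis by (intro exI)
qed

text \<open>Right scalars act through the column index, so the coordinates are read by columns:
  \<open>row_entry\<close> is applied to the transposed matrix and the converse matching, while the
  matrices \<open>?w k\<close> are formed as on the left.\<close>

lemma right_coordinates:
  assumes "finite B" "B \<subseteq> carrier right_cone"
  shows "\<exists>(I :: (nat \<times> nat) set) w p. coordinate_system seqs right_cone (\<lambda>a r. a \<otimes>\<^bsub>seqs\<^esub> r) B I w p"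
proof -
  have B: "B \<subseteq> karoubi_matrices R" using assms(2) by (simp add: right_restrict_scalars_simps)
  obtain I :: "(nat \<times> nat) set" and G where I: "finite I"
    and G: "\<And>k. k \<in> I \<Longrightarrow> matching (G k)"
    and unique: "\<And>A i j. \<lbrakk>A \<in> B; (i, j) \<in> matrix_support R A\<rbrakk> \<Longrightarrow> \<exists>!k. k \<in> I \<and> (i, j) \<in> G k"
    by (rule supports_partition[OF assms(1) B]) blast
  let ?w = "\<lambda>k i j. if (i, j) \<in> G k then \<one> else \<zero>"
    and ?p = "\<lambda>k A. row_entry ((G k)\<inverse>) (\<lambda>i j. A j i)"
  note simps = right_restrict_scalars_simps finite_valued_sequences_simps matching_matrix G
    row_entry_closed row_entry_add row_entry_mult karoubi_matrices_transpose
  have expand: "A = finsum right_cone (\<lambda>k. ?p k A \<odot>\<^bsub>right_cone\<^esub> ?w k) I" if A: "A \<in> B" for A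
  proof -
    have AK: "A \<in> karoubi_matrices R" using A B by blast
    have "finsum right_cone (\<lambda>k. ?p k A \<odot>\<^bsub>right_cone\<^esub> ?w k) I
        = finsum right_cone (\<lambda>k i j. if (i, j) \<in> G k then A i j else \<zero>) I"
    proof (rule abelian_monoid.finsum_cong'[OF _ refl])
      show "?p k A \<odot>\<^bsub>right_cone\<^esub> ?w k = (\<lambda>i j. if (i, j) \<in> G k then A i j else \<zero>)" if "k \<in> I" for k
        using finite_valued_sequences_entry[OF row_entry_closed[OF karoubi_matrices_transpose[OF AK]]]
        by (simp add: simps AK that) (auto simp: fun_eq_iff
            row_entry_eq[OF matching_converse[OF G[OF that]]] karoubi_matrices_entry[OF AK])
    qed (use abelian_group_restrict_scalars in
        \<open>auto simp: right_restrict_scalars_simps restricted_matrix AK abelian_group_def\<close>)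
    also have "\<dots> = A"
      by (rule finsum_partition[OF abelian_group_restrict_scalars(2)])
        (auto simp: right_restrict_scalars_simps I AK unique[OF A])
    finally show ?thesis by (rule sym)
  qed
  have "coordinate_system seqs right_cone (\<lambda>a r. a \<otimes>\<^bsub>seqs\<^esub> r) B I ?w ?p"
    unfolding coordinate_system_def
    by (intro conjI ballI I expand) (simp_all add: simps)
  then show ?thesis by (intro exI)
qed

end

theorem proposition4p3:
  fixes R :: "('a, 'b) ring_scheme"
  assumes "ring R"
  shows "flat_left_module TYPE('n1) TYPE('n2) (finite_valued_sequences R)
           (left_restrict_scalars (diag_matrix R) (Karoubi_cone R)) \<and>
         flat_right_module TYPE('n1) TYPE('n2) (finite_valued_sequences R)
           (right_restrict_scalars (diag_matrix R) (Karoubi_cone R))"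
  by (intro conjI flat_left_moduleI[OF left_module_Karoubi_cone[OF assms] left_coordinates[OF assms]]
      flat_right_moduleI[OF right_module_Karoubi_cone[OF assms] right_coordinates[OF assms]])

end
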